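(* Let $V$ be a set of $m$ elements, $f\colon 2^V\to\mathbb{Z}^+$ a monotone nondecreasing submodular function, $c\colon V\to\mathbb{R}^+$ a cost function with $c(A)=\sum_{v\in A}c(v)$, and $k\le f(V)$ a positive integer, and let $\Delta=\max_{v\in V}f(v)$. For any constant $0<\varepsilon<1/5$, there is a randomized algorithm with value-oracle access to $f$ that, with probability at least $1-3\varepsilon$, outputs a set $V'\subseteq V$ with $f(V')\ge k$ and $$c(V')\le \frac{H(\min\{\Delta,k\})}{1-5\varepsilon}\cdot\min\{c(A)\colon A\subseteq V,\ f(A)\ge k\},$$ and which takes $O\!\left(\frac{\log(km)\log k\,(\log m+\log\log(mk))}{\varepsilon^4}\right)$ adaptive rounds.
   Context: This is the minimum cost submodular cover problem (MinSMC): find $A\subseteq V$ of minimum cost $c(A)$ such that $f(A)\ge k$. $f$ is submodular if $f(S)+f(T)\ge f(S\cap T)+f(S\cup T)$ for all $S,T\subseteq V$, monotone nondecreasing if $f(S)\le f(T)$ for $S\subseteq T$. $H(n)=\sum_{i=1}^n 1/i$ is the $n$-th Harmonic number. Adaptive rounds: given a value oracle for $f$ that receives a set $S$ and returns $f(S)$, an algorithm takes $\gamma$ adaptive rounds if every query to the oracle in round $i\in\{1,\dots,\gamma\}$ depends only on the answers to queries in rounds $1$ to $i-1$, and it performs polynomially many parallel queries in each round. *)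

theory Defs
  imports "HOL-Probability.Probability"
begin

definition submodular_on :: "'a set \<Rightarrow> ('a set \<Rightarrow> nat) \<Rightarrow> bool" where
  "submodular_on V f \<longleftrightarrow>
     (\<forall>S T. S \<subseteq> V \<longrightarrow> T \<subseteq> V \<longrightarrow> f (S \<inter> T) + f (S \<union> T) \<le> f S + f T)"

definition min_cover_cost :: "'a set \<Rightarrow> ('a set \<Rightarrow> nat) \<Rightarrow> ('a \<Rightarrow> real) \<Rightarrow> nat \<Rightarrow> real" where
  "min_cover_cost V f c k = Min (sum c ` {A. A \<subseteq> V \<and> k \<le> f A})"

text \<open>
  A randomized algorithm with value-oracle access, as an interaction tree. It may stop and output
  a set, draw the rest of the computation at random, or submit in one adaptive round a whole batch
  of oracle queries. The continuation of a batch sees only the answers to it (and, through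
  its position in the tree, the answers to earlier rounds and the earlier random choices), never
  the oracle itself, so all queries of a round are fixed before any answer of that round is known.
\<close>

datatype 'a oracle_alg =
    Output "'a set"
  | Random "'a oracle_alg pmf"
  | Query "'a set list" "nat list \<Rightarrow> 'a oracle_alg"

primrec run :: "('a set \<Rightarrow> nat) \<Rightarrow> 'a oracle_alg \<Rightarrow> 'a set pmf" where
  "run f (Output S) = return_pmf S"
| "run f (Random p) = join_pmf (map_pmf (run f) p)"
| "run f (Query Ss g) = run f (g (map f Ss))"

lemma run_Random: "run f (Random p) = bind_pmf p (run f)"
  by (simp add: join_eq_bind_pmf bind_map_pmf)

text \<open>
  \<open>rounds_within V f q r A\<close>: whatever the random choices, \<open>A\<close> run against the oracle \<open>f\<close> on
  subsets of \<open>V\<close> takes at most \<open>r\<close> adaptive rounds, each of at most \<open>q\<close> queries.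
\<close>

inductive rounds_within ::
    "'a set \<Rightarrow> ('a set \<Rightarrow> nat) \<Rightarrow> nat \<Rightarrow> nat \<Rightarrow> 'a oracle_alg \<Rightarrow> bool"
  for V :: "'a set" and f :: "'a set \<Rightarrow> nat" and q :: nat where
  Output: "rounds_within V f q r (Output S)"
| Random: "(\<forall>A\<in>set_pmf p. rounds_within V f q r A) \<Longrightarrow> rounds_within V f q r (Random p)"
| Query: "length Ss \<le> q \<Longrightarrow> (\<forall>S\<in>set Ss. S \<subseteq> V) \<Longrightarrow>
    rounds_within V f q r (g (map f Ss)) \<Longrightarrow>
    rounds_within V f q (Suc r) (Query Ss g)"

text \<open>
  The expression inside the asymptotic bound on the number of rounds. For \<open>m \<ge> 1\<close> and \<open>k \<ge> 1\<close> it
  is positive unless \<open>k = 1\<close> or \<open>(m, k) = (1, 2)\<close>; where it is positive and \<open>\<epsilon> < 1/5\<close>, it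
  exceeds \<open>1\<close>, so that the maximum only affects these degenerate cases (at \<open>k = 1\<close> the factor
  \<open>ln k\<close> vanishes, although queries are needed in general).
\<close>

definition round_bound :: "real \<Rightarrow> nat \<Rightarrow> nat \<Rightarrow> real" where
  "round_bound \<epsilon> m k =
     max 1 (ln (real k * real m) * ln (real k) *
            (ln (real m) + ln (ln (real m * real k))) / \<epsilon> ^ 4)"

end

(*
  After truncating f at k, run a threshold greedy whose density threshold tau falls geometrically.
  One batch at threshold tau: let X be the elements of marginal density at least tau, draw random
  permutations of X, query all their prefixes, and cut each permutation at the first prefix after
  which the elements still of density at least tau carry at most a (1 - eps) fraction of the cost
  of X. So a batch shrinks the cost of X geometrically whatever the random choices are, and all
  costs lie in a window of polynomial ratio (elements of cost at most eps B / m are taken for free,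
  those of cost above m B are discarded, where B is the least b such that the elements of cost at
  most b form a cover, which gives B <= opt <= m B). Hence logarithmically many batches exhaust a
  threshold. Along the permutation the expected gain is at least (1 - eps) tau times the expected
  cost, and a first-moment bound gives a polynomially small but positive probability that the
  prefix really has density (1 - 2 eps) tau; polynomially many independent permutations, tried in
  the same round, make this almost certain. If every batch succeeds, the harmonic bound follows
  from a potential argument.
*)
theory Submission
  imports Defs
begin

section \<open>Submodular functions, harmonic numbers and probability estimates\<close>

lemma submodular_on_subset:
  "submodular_on V f \<Longrightarrow> U \<subseteq> V \<Longrightarrow> submodular_on U f"
  by (auto simp: submodular_on_def)

text \<open>The lattice inequality for \<open>insert v A\<close> and \<open>B\<close>, whose meet is
  \<open>A\<close> and whose join is \<open>insert v B\<close>. The additive form avoids truncated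
  subtraction.\<close>

lemma submodular_marginal:
  assumes "submodular_on U f" "A \<subseteq> B" "B \<subseteq> U" "v \<in> U" "v \<notin> B"
  shows "f (insert v B) + f A \<le> f (insert v A) + f B"
proof -
  have "f (insert v A \<inter> B) + f (insert v A \<union> B) \<le> f (insert v A) + f B"
    using assms(1)[unfolded submodular_on_def, rule_format, of "insert v A" B] assms(2-4) by auto
  moreover have "insert v A \<inter> B = A" "insert v A \<union> B = insert v B"
    using assms by auto
  ultimately show ?thesis by simp
qed

lemma submodular_le_sum_singletons:
  assumes "submodular_on V f" "finite A" "A \<noteq> {}" "A \<subseteq> V"
  shows "f A \<le> (\<Sum>v\<in>A. f {v})"
  using assms(2-4)
proof (induction rule: finite_ne_induct)
  case (insert v A)
  have "f ({v} \<inter> A) + f ({v} \<union> A) \<le> f {v} + f A"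
    using assms(1) insert.prems by (auto simp: submodular_on_def)
  then show ?case using insert by simp
qed simp

text \<open>Each of the \<open>a - b\<close> reciprocals with index in \<open>{b<..a}\<close> is at
  least \<open>1 / a\<close>. This is the inequality behind the harmonic charging.\<close>

lemma harm_diff_ge:
  assumes "b \<le> a" "0 < a"
  shows "real (a - b) / real a \<le> harm a - (harm b :: real)"
proof -
  have "(harm a :: real) - harm b = (\<Sum>i\<in>{b<..a}. inverse (real i))"
  proof -
    have "{1..a} = {1..b} \<union> {b<..a}" using assms by auto
    then show ?thesis unfolding harm_def by (subst (1) \<open>{1..a} = _\<close>, subst sum.union_disjoint) auto
  qed
  also have "(\<Sum>i\<in>{b<..a}. inverse (real i)) \<ge> (\<Sum>i\<in>{b<..a}. inverse (real a))"
    by (intro sum_mono) (auto intro!: le_imp_inverse_le)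
  finally show ?thesis using assms by (simp add: divide_inverse)
qed

text \<open>Success probabilities of successive stages multiply. The second bound is required only
  after outcomes in \<open>G\<close>, so no independence is involved.\<close>

lemma prob_bind_pmf_ge:
  assumes "\<And>x. x \<in> set_pmf p \<Longrightarrow> x \<in> G \<Longrightarrow> a \<le> measure_pmf.prob (h x) E"
    and "b \<le> measure_pmf.prob p G" "0 \<le> a"
  shows "b * a \<le> measure_pmf.prob (bind_pmf p h) E"
proof -
  have "ennreal (b * a) \<le> ennreal (a * measure_pmf.prob p G)"
    using assms(2,3) by (intro ennreal_leI) (simp add: mult_left_mono mult.commute)
  also have "\<dots> = (\<integral>\<^sup>+ x. ennreal a * indicator G x \<partial>p)"
    using assms(3) by (simp add: nn_integral_cmult measure_pmf.emeasure_eq_measure ennreal_mult)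
  also have "\<dots> \<le> (\<integral>\<^sup>+ x. emeasure (h x) E \<partial>p)"
    using assms(1,3) by (intro nn_integral_mono_AE)
      (auto simp: AE_measure_pmf_iff measure_pmf.emeasure_eq_measure indicator_def)
  also have "\<dots> = emeasure (bind_pmf p h) E" by simp
  finally show ?thesis by (simp add: measure_pmf.emeasure_eq_measure)
qed

lemma prob_replicate_pmf_none:
  assumes "\<alpha> \<le> measure_pmf.prob p G"
  shows "measure_pmf.prob (replicate_pmf n p) {xs. set xs \<inter> G = {}} \<le> (1 - \<alpha>) ^ n"
proof (induction n)
  case (Suc n)
  have "replicate_pmf (Suc n) p = map_pmf (\<lambda>(x, xs). x # xs) (pair_pmf p (replicate_pmf n p))"
    by (simp add: pair_pmf_def map_bind_pmf map_pmf_def bind_assoc_pmf bind_return_pmf)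
  then have "measure_pmf.prob (replicate_pmf (Suc n) p) {xs. set xs \<inter> G = {}} =
      measure_pmf.prob (pair_pmf p (replicate_pmf n p)) ((\<lambda>(x, xs). x # xs) -` {xs. set xs \<inter> G = {}})"
    by simp
  also have "(\<lambda>(x, xs). x # xs) -` {xs. set xs \<inter> G = {}} = (- G) \<times> {xs. set xs \<inter> G = {}}"
    by auto
  also have "measure_pmf.prob (pair_pmf p (replicate_pmf n p)) \<dots> =
      measure_pmf.prob p (- G) * measure_pmf.prob (replicate_pmf n p) {xs. set xs \<inter> G = {}}"
  proof -
    let ?P = "set_pmf p" and ?Q = "set_pmf (replicate_pmf n p)"
    \<comment> \<open>The product rule is for countable sets, hence the restriction to the
      supports.\<close>
    have "measure_pmf.prob (pair_pmf p (replicate_pmf n p)) ((- G) \<times> {xs. set xs \<inter> G = {}})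
       = measure_pmf.prob (pair_pmf p (replicate_pmf n p))
           ((- G \<inter> ?P) \<times> ({xs. set xs \<inter> G = {}} \<inter> ?Q))"
      by (subst measure_Int_set_pmf[symmetric]) (auto intro!: arg_cong2[where f = measure])
    also have "\<dots> = measure_pmf.prob p (- G \<inter> ?P)
        * measure_pmf.prob (replicate_pmf n p) ({xs. set xs \<inter> G = {}} \<inter> ?Q)"
      by (intro measure_pmf_prob_product) (auto intro: countable_subset[OF _ countable_set_pmf])
    finally show ?thesis by (simp add: measure_Int_set_pmf)
  qed
  also have "measure_pmf.prob p (- G) = 1 - measure_pmf.prob p G"
    using measure_pmf.prob_compl[of G p] by (simp add: Compl_eq_Diff_UNIV)
  also have "(1 - measure_pmf.prob p G) * measure_pmf.prob (replicate_pmf n p) {xs. set xs \<inter> G = {}}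
       \<le> (1 - \<alpha>) * (1 - \<alpha>) ^ n"
    using assms Suc.IH by (intro mult_mono) (auto intro: order_trans[OF _ measure_pmf.prob_le_1])
  finally show ?case by simp
qed simp

section \<open>Rounds of queries\<close>

text \<open>The continuation is written as a function of a whole oracle, rebuilt here by table
  lookup from the answers. Outside the batch the lookup is unspecified, so every use has to show
  that \<open>h\<close> reads only queried sets.\<close>

definition ask :: "'a set list \<Rightarrow> (('a set \<Rightarrow> nat) \<Rightarrow> 'a oracle_alg) \<Rightarrow> 'a oracle_alg" where
  "ask Ss h = Query Ss (\<lambda>as. h (\<lambda>S. the (map_of (zip Ss as) S)))"

lemma ask_continuation:
  assumes "\<And>F. (\<forall>S\<in>set Ss. F S = f S) \<Longrightarrow> h F = h f"
  shows "h (\<lambda>S. the (map_of (zip Ss (map f Ss)) S)) = h f"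
  by (rule assms) (simp add: map_of_zip_map)

lemma run_ask:
  assumes "\<And>F. (\<forall>S\<in>set Ss. F S = f S) \<Longrightarrow> h F = h f"
  shows "run f (ask Ss h) = run f (h f)"
  using ask_continuation[of Ss f h, OF assms] by (simp add: ask_def)

lemma rounds_within_ask:
  assumes "\<And>F. (\<forall>S\<in>set Ss. F S = f S) \<Longrightarrow> h F = h f"
    and "length Ss \<le> q" "\<And>S. S \<in> set Ss \<Longrightarrow> S \<subseteq> V"
    and "rounds_within V f q r (h f)"
  shows "rounds_within V f q (Suc r) (ask Ss h)"
  unfolding ask_def using assms(2-4)
  by (intro rounds_within.Query) (auto simp: ask_continuation[of Ss f h, OF assms(1)])

section \<open>The batched threshold greedy\<close>

text \<open>There are no assumptions, and decisions take the oracle as an argument: the algorithm is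
  fixed before anything is known about \<open>f\<close>. \<open>L\<close> is the number of
  permutations tried per batch.\<close>

locale batch_greedy =
  fixes us :: "'a list" and c :: "'a \<Rightarrow> real" and k :: nat and \<epsilon> :: real and L :: nat
begin

text \<open>Marginal of the truncation of \<open>F\<close> at \<open>k\<close>, so that no gain
  exceeds \<open>k\<close>.\<close>

definition gain :: "('a set \<Rightarrow> nat) \<Rightarrow> 'a \<Rightarrow> 'a set \<Rightarrow> nat" where
  "gain F v A = min (F (insert v A)) k - min (F A) k"

definition cands :: "('a set \<Rightarrow> nat) \<Rightarrow> real \<Rightarrow> 'a set \<Rightarrow> 'a set" where
  "cands F \<tau> A = {v \<in> set us - A. \<tau> * c v \<le> real (gain F v A)}"

text \<open>\<open>W\<close> stays the cost of the candidates at the start of the batch, while the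
  candidates are recomputed for every prefix.\<close>

primrec stop :: "('a set \<Rightarrow> nat) \<Rightarrow> real \<Rightarrow> real \<Rightarrow> 'a set \<Rightarrow> 'a list \<Rightarrow> 'a set" where
  "stop F \<tau> W A [] = A"
| "stop F \<tau> W A (x # xs) =
     (if sum c (cands F \<tau> A) \<le> (1 - \<epsilon>) * W then A else stop F \<tau> W (insert x A) xs)"

text \<open>All prefixes and their extensions by one element: the sets whose values
  \<open>stop\<close> and \<open>accept\<close> may read, wherever the cut falls.\<close>

primrec queries :: "'a set \<Rightarrow> 'a list \<Rightarrow> 'a set list" where
  "queries A [] = A # map (\<lambda>v. insert v A) us"
| "queries A (x # xs) = (A # map (\<lambda>v. insert v A) us) @ queries (insert x A) xs"

text \<open>The expected gain is only guaranteed to be \<open>(1 - \<epsilon>) * \<tau>\<close>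
  times the expected cost; the second \<epsilon> of slack is what gives acceptance a positive
  probability.\<close>

definition accept :: "('a set \<Rightarrow> nat) \<Rightarrow> real \<Rightarrow> 'a set \<Rightarrow> 'a set \<Rightarrow> bool" where
  "accept F \<tau> A B \<longleftrightarrow>
     (1 - 2 * \<epsilon>) * \<tau> * sum c (B - A) \<le> real (min (F B) k) - real (min (F A) k)"

text \<open>If no permutation is accepted, the batch adds nothing and the run goes on from
  \<open>A\<close>.\<close>

definition select ::
    "('a set \<Rightarrow> nat) \<Rightarrow> real \<Rightarrow> real \<Rightarrow> 'a set \<Rightarrow> 'a list list \<Rightarrow> 'a set" where
  "select F \<tau> W A xss =
     (case find (\<lambda>xs. accept F \<tau> A (stop F \<tau> W A xs)) xss of
        None \<Rightarrow> A | Some xs \<Rightarrow> stop F \<tau> W A xs)"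

definition samples :: "'a set \<Rightarrow> 'a list list pmf" where
  "samples X = replicate_pmf L (pmf_of_set (permutations_of_set X))"

text \<open>The permutations depend on the candidates, so each list entry takes two rounds: one
  finds the candidates, the other tries all permutations at once.\<close>

primrec loop :: "real list \<Rightarrow> 'a set \<Rightarrow> 'a oracle_alg" where
  "loop [] A = Output A"
| "loop (\<tau> # ts) A =
     ask (A # map (\<lambda>v. insert v A) us) (\<lambda>F.
       let X = cands F \<tau> A in
       Random (map_pmf (\<lambda>xss. ask (concat (map (queries A) xss))
           (\<lambda>F'. loop ts (select F' \<tau> (sum c X) A xss)))
         (samples X)))"

primrec levels :: "nat \<Rightarrow> nat \<Rightarrow> real \<Rightarrow> real list" where
  "levels n 0 \<tau> = []"
| "levels n (Suc j) \<tau> = replicate n \<tau> @ levels n j ((1 - \<epsilon>) * \<tau>)"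

lemma cands_cong:
  assumes "\<forall>S\<in>set (A # map (\<lambda>v. insert v A) us). F S = f S"
  shows "cands F \<tau> A = cands f \<tau> A"
  using assms by (auto simp: cands_def gain_def)

lemma queries_first: "A \<in> set (queries A xs)" "v \<in> set us \<Longrightarrow> insert v A \<in> set (queries A xs)"
  by (cases xs; auto)+

text \<open>The second conjunct is there for the acceptance test, which also reads the value at the
  set where the permutation is cut.\<close>

lemma stop_cong:
  assumes "\<forall>S\<in>set (queries A xs). F S = f S"
  shows "stop F \<tau> W A xs = stop f \<tau> W A xs \<and> F (stop f \<tau> W A xs) = f (stop f \<tau> W A xs)"
  using assms
proof (induction xs arbitrary: A)
  case (Cons x xs)
  have "cands F \<tau> A = cands f \<tau> A"
    using Cons.prems by (intro cands_cong) auto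
  then show ?case using Cons by auto
qed simp

lemma select_cong:
  assumes "\<forall>S\<in>set (concat (map (queries A) xss)). F S = f S"
  shows "select F \<tau> W A xss = select f \<tau> W A xss"
proof -
  have 1: "stop F \<tau> W A xs = stop f \<tau> W A xs \<and> F (stop f \<tau> W A xs) = f (stop f \<tau> W A xs)
      \<and> F A = f A" if "xs \<in> set xss" for xs
    using stop_cong[of A xs F f \<tau> W] assms that queries_first(1)[of A xs] by auto
  then have "find (\<lambda>xs. accept F \<tau> A (stop F \<tau> W A xs)) xss
      = find (\<lambda>xs. accept f \<tau> A (stop f \<tau> W A xs)) xss"
    by (intro find_cong) (auto simp: accept_def)
  moreover have "xs \<in> set xss" if "find P xss = Some xs" for xs P
    using that by (auto simp: find_Some_iff)
  ultimately show ?thesis using 1 by (auto simp: select_def split: option.split)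
qed

text \<open>From here on the interaction tree can be forgotten: the run is a random walk on
  sets.\<close>

lemma run_loop_Cons:
  "run f (loop (\<tau> # ts) A) = bind_pmf (samples (cands f \<tau> A))
     (\<lambda>xss. run f (loop ts (select f \<tau> (sum c (cands f \<tau> A)) A xss)))"
proof -
  have *: "run f (ask (concat (map (queries A) xss))
            (\<lambda>F'. loop ts (select F' \<tau> W A xss))) = run f (loop ts (select f \<tau> W A xss))" for W xss
    by (subst run_ask) (use select_cong[of A xss] in \<open>metis, simp\<close>)
  show ?thesis unfolding loop.simps
    by (subst run_ask, simp only: cands_cong[of A _ f])
      (simp add: Let_def run_Random bind_map_pmf * del: run.simps)
qed

lemma stop_bounds: "A \<subseteq> stop F \<tau> W A xs" "stop F \<tau> W A xs \<subseteq> A \<union> set xs"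
  by (induction xs arbitrary: A) (auto split: if_splits, blast+)

lemma length_queries: "length (queries A xs) = (length us + 1) * (length xs + 1)"
  by (induction xs arbitrary: A) auto

lemma queries_subset: "S \<in> set (queries A xs) \<Longrightarrow> S \<subseteq> A \<union> set us \<union> set xs"
  by (induction xs arbitrary: A) auto

lemma cands_subset: "cands F \<tau> A \<subseteq> set us - A"
  by (auto simp: cands_def)

lemma finite_cands [simp]: "finite (cands F \<tau> A)"
  by (rule finite_subset[OF cands_subset]) auto

lemma samples_set:
  assumes "finite X" "xss \<in> set_pmf (samples X)" "xs \<in> set xss"
  shows "set xs = X" "distinct xs" "length xss = L"
  using assms by (auto simp: samples_def set_replicate_pmf in_lists_conv_set dest: permutations_of_setD)

lemma select_bounds:
  assumes "\<And>xs. xs \<in> set xss \<Longrightarrow> set xs \<subseteq> X"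
  shows "A \<subseteq> select f \<tau> W A xss" "select f \<tau> W A xss \<subseteq> A \<union> X"
proof -
  have "xs \<in> set xss" if "find P xss = Some xs" for xs P
    using that by (auto simp: find_Some_iff)
  then show "A \<subseteq> select f \<tau> W A xss" "select f \<tau> W A xss \<subseteq> A \<union> X"
    using stop_bounds assms by (auto simp: select_def split: option.split) fastforce+
qed

lemma rounds_within_loop:
  assumes "distinct us" "set us \<subseteq> V" "A \<subseteq> set us" "1 \<le> L"
    and q: "L * (length us + 1)\<^sup>2 \<le> q"
  shows "rounds_within V f q (2 * length ts) (loop ts A)"
  using assms(3)
proof (induction ts arbitrary: A)
  case Nil
  then show ?case by (auto intro: rounds_within.Output)
next
  case (Cons \<tau> ts)
  let ?X = "cands f \<tau> A"
  \<comment> \<open>The candidate round asks \<open>length us + 1\<close> queries;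
    \<open>1 \<le> L\<close> makes them fit under the bound set by the permutation round.\<close>
  have "length us + 1 \<le> (length us + 1)\<^sup>2" by (simp add: power2_eq_square)
  also have "\<dots> \<le> L * (length us + 1)\<^sup>2" using \<open>1 \<le> L\<close> by simp
  finally have q1: "length us + 1 \<le> q" using q by linarith
  have main: "rounds_within V f q (Suc (2 * length ts))
     (Random (map_pmf (\<lambda>xss. ask (concat (map (queries A) xss))
           (\<lambda>F'. loop ts (select F' \<tau> (sum c ?X) A xss))) (samples ?X)))"
  proof (rule rounds_within.Random, clarsimp)
    fix xss assume xss: "xss \<in> set_pmf (samples ?X)"
    have len: "length (concat (map (queries A) xss)) \<le> q"
    proof -
      have lenq: "length (queries A xs) \<le> (length us + 1)\<^sup>2" if "xs \<in> set xss" for xs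
      proof -
        have "length xs = card ?X"
          using samples_set(1,2)[OF finite_cands xss that] distinct_card by metis
        also have "\<dots> \<le> card (set us)"
          by (rule card_mono) (use cands_subset in auto)
        finally have "length xs \<le> length us"
          using distinct_card[OF assms(1)] by simp
        then show ?thesis unfolding length_queries power2_eq_square by (intro mult_le_mono) auto
      qed
      have "length (concat (map (queries A) xss)) \<le> length xss * (length us + 1)\<^sup>2"
        using lenq by (induction xss) (auto simp del: length_queries, fastforce)
      also have "length xss = L" using xss by (auto simp: samples_def set_replicate_pmf)
      finally show ?thesis using q by linarith
    qed
    have sub: "S \<subseteq> V" if "S \<in> set (concat (map (queries A) xss))" for S
    proof -
      from that obtain xs where xs: "xs \<in> set xss" "S \<in> set (queries A xs)" by auto
      have "set xs \<subseteq> set us"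
        using samples_set(1)[OF finite_cands xss xs(1)] cands_subset by blast
      then show ?thesis using queries_subset[OF xs(2)] Cons.prems assms(2) by blast
    qed
    have "set xs \<subseteq> ?X" if "xs \<in> set xss" for xs
      using samples_set(1)[OF finite_cands xss that] by simp
    then have "select f \<tau> (sum c ?X) A xss \<subseteq> A \<union> ?X" by (rule select_bounds(2))
    then have "rounds_within V f q (2 * length ts) (loop ts (select f \<tau> (sum c ?X) A xss))"
      using Cons.prems cands_subset by (intro Cons.IH) blast
    then show "rounds_within V f q (Suc (2 * length ts)) (ask (concat (map (queries A) xss))
           (\<lambda>F'. loop ts (select F' \<tau> (sum c ?X) A xss)))"
      by (intro rounds_within_ask len sub) (use select_cong[of A xss] in metis)
  qed
  have "rounds_within V f q (Suc (Suc (2 * length ts))) (loop (\<tau> # ts) A)"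
    unfolding loop.simps
  proof (rule rounds_within_ask)
    show "length (A # map (\<lambda>v. insert v A) us) \<le> q" using q1 by simp
    show "S \<subseteq> V" if "S \<in> set (A # map (\<lambda>v. insert v A) us)" for S
      using that Cons.prems assms(2) by auto
  qed (simp only: cands_cong[of A _ f], use main in \<open>simp add: Let_def\<close>)
  then show ?case by simp
qed

end

section \<open>Success probability and cost of the greedy\<close>

text \<open>Elements of cost at most \<open>cl\<close> are taken in advance and none costs more than
  \<open>ch\<close>. The ratio of the two governs both the number of batches per threshold and the
  success probability of a permutation.\<close>

locale covering = batch_greedy us c k \<epsilon> L
  for us :: "'a list" and c :: "'a \<Rightarrow> real" and k :: nat and \<epsilon> :: real and L :: nat +
  fixes f :: "'a set \<Rightarrow> nat" and cl ch :: real
  assumes submod: "submodular_on (set us) f"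
    and mono: "mono_on (Pow (set us)) f"
    and feasible: "k \<le> f (set us)"
    and eps: "0 < \<epsilon>" "\<epsilon> < 1 / 5"
    and cl: "0 < cl" "cl \<le> ch"
    and cost: "\<And>v. v \<in> set us \<Longrightarrow> 0 \<le> c v" "\<And>v. v \<in> set us \<Longrightarrow> c v \<le> ch"
begin

section \<open>The truncated objective and its marginals\<close>

definition g :: "'a set \<Rightarrow> nat" where "g A = min (f A) k"

definition cheap :: "'a set" where "cheap = {v \<in> set us. c v \<le> cl}"

definition admissible :: "'a set \<Rightarrow> bool" where "admissible A \<longleftrightarrow> cheap \<subseteq> A \<and> A \<subseteq> set us"

abbreviation mg :: "'a \<Rightarrow> 'a set \<Rightarrow> nat" where "mg \<equiv> gain f"

text \<open>Every density is at most \<open>\<tau> / (1 - \<epsilon>)\<close>, multiplied out so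
  that elements of cost zero are included.\<close>

definition sparse :: "real \<Rightarrow> 'a set \<Rightarrow> bool" where
  "sparse \<tau> A \<longleftrightarrow> (\<forall>v\<in>set us. (1 - \<epsilon>) * real (mg v A) \<le> \<tau> * c v)"

lemma f_mono: "A \<subseteq> B \<Longrightarrow> B \<subseteq> set us \<Longrightarrow> f A \<le> f B"
  using mono by (auto simp: mono_on_def)

lemma g_mono: "A \<subseteq> B \<Longrightarrow> B \<subseteq> set us \<Longrightarrow> g A \<le> g B"
  using f_mono[of A B] by (auto simp: g_def)

lemma g_le: "g A \<le> k"
  by (simp add: g_def)

lemma g_univ: "g (set us) = k"
  using feasible by (simp add: g_def)

lemma mg_in: "v \<in> A \<Longrightarrow> mg v A = 0"
  by (simp add: gain_def insert_absorb)

lemma g_insert: "A \<subseteq> set us \<Longrightarrow> v \<in> set us \<Longrightarrow> g (insert v A) = g A + mg v A"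
  using g_mono[of A "insert v A"] by (simp add: gain_def g_def subset_insertI)

text \<open>Decreasing marginals survive truncation because \<open>f\<close> is monotone: the
  comparisons between the four values settle every case of the minima.\<close>

lemma mg_antimono:
  assumes "A \<subseteq> B" "B \<subseteq> set us" "v \<in> set us"
  shows "mg v B \<le> mg v A"
proof (cases "v \<in> B")
  case False
  have "f (insert v B) + f A \<le> f (insert v A) + f B"
    using submod assms False by (intro submodular_marginal) auto
  moreover have "f A \<le> f B" "f B \<le> f (insert v B)" "f A \<le> f (insert v A)"
      "f (insert v A) \<le> f (insert v B)"
    using assms by (auto intro!: f_mono)
  ultimately show ?thesis by (auto simp: gain_def min_def)
qed (simp add: mg_in)

lemma g_union_le:
  assumes "A \<subseteq> set us" "R \<subseteq> set us"
  shows "g (A \<union> R) \<le> g A + (\<Sum>v\<in>R. mg v A)"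
proof -
  have "finite R" using assms(2) finite_subset by blast
  then show ?thesis using assms(2)
  proof (induction R)
    case (insert v R)
    have "g (A \<union> insert v R) = g (A \<union> R) + mg v (A \<union> R)"
      using g_insert[of "A \<union> R" v] insert.prems assms(1) by auto
    also have "mg v (A \<union> R) \<le> mg v A"
      using insert.prems assms(1) by (intro mg_antimono) auto
    finally show ?case using insert by simp
  qed simp
qed

lemma cost_outside: "admissible A \<Longrightarrow> v \<in> set us - A \<Longrightarrow> cl < c v"
  by (force simp: admissible_def cheap_def)

lemma cands_antimono:
  assumes "A \<subseteq> B" "B \<subseteq> set us"
  shows "cands f \<tau> B \<subseteq> cands f \<tau> A - B"
proof
  fix v assume v: "v \<in> cands f \<tau> B"
  then have "mg v B \<le> mg v A" using assms by (intro mg_antimono) (auto simp: cands_def)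
  then have "real (mg v B) \<le> real (mg v A)" by simp
  moreover have "\<tau> * c v \<le> real (mg v B)" using v by (auto simp: cands_def)
  ultimately have "\<tau> * c v \<le> real (mg v A)" by linarith
  then show "v \<in> cands f \<tau> A - B" using v assms(1) by (auto simp: cands_def)
qed

section \<open>One batch: shrinkage of the candidates and probability of acceptance\<close>

lemma sum_cost_nonneg: "A \<subseteq> set us \<Longrightarrow> 0 \<le> sum c A"
  using cost by (intro sum_nonneg) auto

lemma sum_cost_mono: "A \<subseteq> B \<Longrightarrow> B \<subseteq> set us \<Longrightarrow> sum c A \<le> sum c B"
  using cost by (intro sum_mono2) (auto intro: finite_subset)

lemma sparse_antimono:
  assumes "sparse \<tau> A" "A \<subseteq> B" "B \<subseteq> set us"
  shows "sparse \<tau> B"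
  unfolding sparse_def
proof
  fix v assume v: "v \<in> set us"
  have "(1 - \<epsilon>) * real (mg v B) \<le> (1 - \<epsilon>) * real (mg v A)"
    using mg_antimono[OF assms(2,3) v] eps by (intro mult_left_mono) auto
  then show "(1 - \<epsilon>) * real (mg v B) \<le> \<tau> * c v"
    using assms(1) v by (force simp: sparse_def)
qed

text \<open>Either the test cuts the permutation, or it is used up. In the second case all
  candidates have been inserted, and no new ones arise since gains only fall.\<close>

lemma stop_shrinks:
  assumes "B \<subseteq> set us" "set xs \<subseteq> set us" "cands f \<tau> B \<subseteq> set xs" "0 \<le> W"
  shows "sum c (cands f \<tau> (stop f \<tau> W B xs)) \<le> (1 - \<epsilon>) * W"
  using assms
proof (induction xs arbitrary: B)
  case Nil
  then show ?case using eps by simp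
next
  case (Cons x xs)
  have "cands f \<tau> (insert x B) \<subseteq> set xs"
    using cands_antimono[of B "insert x B" \<tau>] Cons.prems by auto
  then show ?case using Cons by auto
qed

text \<open>
  As long as the candidates keep more than a \<open>1 - \<epsilon>\<close> fraction of the original cost, a uniformly
  random remaining element has expected gain at least \<open>(1 - \<epsilon>) \<tau>\<close> times its expected cost, so the
  potential is a submartingale along the permutation.
\<close>

lemma expectation_stop_ge:
  fixes \<Psi> :: "'a set \<Rightarrow> real" and \<tau> :: real
  defines "\<Psi> \<equiv> \<lambda>B. real (g B) - (1 - \<epsilon>) * \<tau> * sum c B"
  assumes "B \<subseteq> set us" "R \<subseteq> set us - B" "cands f \<tau> B \<subseteq> R" "sum c R \<le> W" "0 \<le> \<tau>"
  shows "\<Psi> B \<le> measure_pmf.expectation (pmf_of_set (permutations_of_set R))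
           (\<lambda>xs. \<Psi> (stop f \<tau> W B xs))"
proof -
  have "finite R" using assms(3) by (meson finite_Diff finite_set finite_subset)
  then show ?thesis using assms(2-5)
  proof (induction R arbitrary: B rule: finite_psubset_induct)
    case (psubset R)
    show ?case
    proof (cases "R = {} \<or> sum c (cands f \<tau> B) \<le> (1 - \<epsilon>) * W")
      case True
      have "stop f \<tau> W B xs = B" if "xs \<in> permutations_of_set R" for xs
        using True that by (cases xs) auto
      then have "measure_pmf.expectation (pmf_of_set (permutations_of_set R))
           (\<lambda>xs. \<Psi> (stop f \<tau> W B xs)) =
         measure_pmf.expectation (pmf_of_set (permutations_of_set R)) (\<lambda>xs. \<Psi> B)"
        using psubset.hyps by (intro Bochner_Integration.integral_cong_AE) (auto simp: AE_measure_pmf_iff)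
      then show ?thesis by simp
    next
      case False
      then have ne: "R \<noteq> {}" and big: "(1 - \<epsilon>) * W < sum c (cands f \<tau> B)" by auto
      let ?E = "\<lambda>x. measure_pmf.expectation (pmf_of_set (permutations_of_set (R - {x})))
                  (\<lambda>xs. \<Psi> (stop f \<tau> W (insert x B) xs))"
      have IH: "\<Psi> (insert x B) \<le> ?E x" if x: "x \<in> R" for x
      proof (rule psubset.IH)
        show "cands f \<tau> (insert x B) \<subseteq> R - {x}"
          using cands_antimono[of B "insert x B" \<tau>] psubset.prems x by auto
        have "sum c (R - {x}) \<le> sum c R"
          using psubset.prems(2) by (intro sum_cost_mono) auto
        then show "sum c (R - {x}) \<le> W" using psubset.prems by linarith
      qed (use x psubset.prems in auto)
      have diff: "\<Psi> (insert x B) = \<Psi> B + (real (mg x B) - (1 - \<epsilon>) * \<tau> * c x)" if "x \<in> R" for x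
      proof -
        have "x \<notin> B" "x \<in> set us" using that psubset.prems by auto
        moreover have "finite B" using psubset.prems(1) finite_subset by blast
        ultimately show ?thesis
          using g_insert[of B x] psubset.prems(1) by (simp add: \<Psi>_def algebra_simps)
      qed
      \<comment> \<open>The remaining candidates cost more than \<open>(1 - \<epsilon>) * W\<close>
        and each gains at least \<tau> times its cost; all other elements of \<open>R\<close> gain
        at least zero. Hence the average drift over \<open>R\<close> is nonnegative.\<close>
      have "(1 - \<epsilon>) * \<tau> * sum c R \<le> (1 - \<epsilon>) * \<tau> * W"
        using psubset.prems assms(6) eps by (intro mult_left_mono) auto
      also have "\<dots> = \<tau> * ((1 - \<epsilon>) * W)" by simp
      also have "\<dots> \<le> \<tau> * sum c (cands f \<tau> B)"
        using big assms(6) by (intro mult_left_mono) auto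
      also have "\<dots> \<le> (\<Sum>x\<in>cands f \<tau> B. real (mg x B))"
        unfolding sum_distrib_left by (intro sum_mono) (auto simp: cands_def)
      also have "\<dots> \<le> (\<Sum>x\<in>R. real (mg x B))"
        using psubset.hyps psubset.prems by (intro sum_mono2) auto
      finally have drift: "0 \<le> (\<Sum>x\<in>R. real (mg x B) - (1 - \<epsilon>) * \<tau> * c x)"
        by (simp add: sum_subtractf sum_distrib_left)
      have "real (card R) * \<Psi> B \<le> (\<Sum>x\<in>R. \<Psi> (insert x B))"
        using drift by (simp add: diff sum.distrib)
      also have "\<dots> \<le> (\<Sum>x\<in>R. ?E x)" by (intro sum_mono IH)
      finally have "\<Psi> B \<le> (\<Sum>x\<in>R. ?E x) / real (card R)"
        using ne psubset.hyps by (simp add: field_simps card_gt_0_iff)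
      also have "\<dots> = measure_pmf.expectation (pmf_of_set (permutations_of_set R))
           (\<lambda>xs. \<Psi> (stop f \<tau> W B xs))"
      proof -
        have fin: "finite (set_pmf (pmf_of_set (permutations_of_set (R - {x}))))" for x
          using psubset.hyps by simp
        \<comment> \<open>Conditioning on the first element: it is uniform on \<open>R\<close>, and
          the rest is a uniform permutation of what remains.\<close>
        have "measure_pmf.expectation (pmf_of_set (permutations_of_set R))
             (\<lambda>xs. \<Psi> (stop f \<tau> W B xs)) =
           (\<Sum>x\<in>R. measure_pmf.expectation
              (map_pmf (\<lambda>xs. x # xs) (pmf_of_set (permutations_of_set (R - {x}))))
              (\<lambda>xs. \<Psi> (stop f \<tau> W B xs)) /\<^sub>R real (card R))"
          unfolding random_permutation_of_set[OF psubset.hyps ne]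
            map_pmf_def[of "\<lambda>xs. _ # xs", symmetric]
          using ne psubset.hyps fin by (intro pmf_expectation_bind_pmf_of_set) auto
        also have "\<dots> = (\<Sum>x\<in>R. ?E x) / real (card R)"
          using big by (simp add: sum_distrib_left divide_inverse mult.commute)
        finally show ?thesis by simp
      qed
      finally show ?thesis .
    qed
  qed
qed

lemma success_rate_le_1: "\<epsilon> * (1 - \<epsilon>) * cl / (real (length us) * ch) \<le> 1"
proof (cases "us = []")
  case False
  have "\<epsilon> * (1 - \<epsilon>) \<le> 1 * 1" using eps by (intro mult_mono) auto
  then have "\<epsilon> * (1 - \<epsilon>) * cl \<le> 1 * cl" using cl by (intro mult_right_mono) auto
  also have "\<dots> \<le> ch" using cl by simp
  also have "\<dots> \<le> real (length us) * ch" using False cl by (cases us) auto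
  finally show ?thesis using False cl by (simp add: divide_le_eq)
qed simp

text \<open>A first-moment bound. The expected change of \<open>\<Psi>\<close> is nonnegative; a
  rejected prefix lowers \<open>\<Psi>\<close> by at least \<open>\<epsilon> * \<tau> * cl\<close>,
  while an accepted one, even after adding this amount, raises it by at most
  \<open>D / (1 - \<epsilon>)\<close>. Thus acceptance cannot be rarer than the ratio of these two
  numbers.\<close>

lemma prob_accept:
  assumes A: "admissible A" and sp: "sparse \<tau> A" and \<tau>: "0 < \<tau>"
  defines "X \<equiv> cands f \<tau> A"
  shows "\<epsilon> * (1 - \<epsilon>) * cl / (real (length us) * ch) \<le>
      measure_pmf.prob (pmf_of_set (permutations_of_set X))
        {xs. accept f \<tau> A (stop f \<tau> (sum c X) A xs)}"
proof (cases "X = {}")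
  case True
  have "accept f \<tau> A A" by (simp add: accept_def)
  then have "measure_pmf.prob (pmf_of_set (permutations_of_set X))
      {xs. accept f \<tau> A (stop f \<tau> (sum c X) A xs)} = 1"
    using True by (simp add: pmf_of_set_singleton)
  then show ?thesis using success_rate_le_1 by simp
next
  case False
  let ?p = "pmf_of_set (permutations_of_set X)"
  let ?st = "\<lambda>xs. stop f \<tau> (sum c X) A xs"
  let ?acc = "{xs. accept f \<tau> A (?st xs)}"
  define \<Psi> where "\<Psi> = (\<lambda>B. real (g B) - (1 - \<epsilon>) * \<tau> * sum c B)"
  define D where "D = \<tau> * (real (length us) * ch)"
  have XU: "X \<subseteq> set us - A" unfolding X_def by (rule cands_subset)
  have AU: "A \<subseteq> set us" using A by (simp add: admissible_def)
  have finX: "finite X" by (simp add: X_def)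
  have finp: "finite (set_pmf ?p)" using finX by simp
  obtain x0 where x0: "x0 \<in> X" using False by blast
  have chpos: "0 < ch" using cost_outside[OF A, of x0] cost(2)[of x0] x0 XU cl by force
  have cX: "cl \<le> sum c X"
    using cost_outside[OF A, of x0] x0 XU cost finX member_le_sum[of x0 X c] by force
  have "sum c X \<le> (\<Sum>x\<in>X. ch)" using XU cost by (intro sum_mono) auto
  also have "\<dots> = real (card X) * ch" by simp
  also have "\<dots> \<le> real (length us) * ch"
  proof -
    have "card X \<le> card (set us)" using XU by (intro card_mono) auto
    also have "\<dots> \<le> length us" by (rule card_length)
    finally show ?thesis using chpos by simp
  qed
  finally have cXle: "sum c X \<le> real (length us) * ch" .
  have Z: "(1 - \<epsilon>) * (\<Psi> (?st xs) - \<Psi> A + \<epsilon> * \<tau> * cl) \<le> D * indicator ?acc xs"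
    if xs: "xs \<in> permutations_of_set X" for xs
  proof -
    let ?B = "?st xs"
    have set: "set xs = X" "distinct xs" using xs by (auto dest: permutations_of_setD)
    have B: "A \<subseteq> ?B" "?B \<subseteq> A \<union> X" using stop_bounds(1)[of A f \<tau> "sum c X" xs] stop_bounds(2)[of f \<tau> "sum c X" A xs] set by auto
    obtain y ys where y: "xs = y # ys" using set False by (cases xs) auto
    \<comment> \<open>The test fails on the empty prefix, so at least one element, of cost above
      \<open>cl\<close>, is always inserted.\<close>
    have "\<not> sum c X \<le> (1 - \<epsilon>) * sum c X"
    proof -
      have "0 < \<epsilon> * sum c X" using eps cX cl by simp
      then show ?thesis by (simp add: algebra_simps)
    qed
    then have "?B = stop f \<tau> (sum c X) (insert y A) ys" by (simp add: y X_def)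
    then have "y \<in> ?B" using stop_bounds(1)[of "insert y A" f \<tau> "sum c X" ys] by auto
    moreover have "y \<in> X" using y set by auto
    ultimately have yB: "y \<in> ?B - A" using XU by auto
    have BU: "?B \<subseteq> set us" using B XU AU by auto
    have finB: "finite ?B" using BU finite_subset by blast
    have cB: "cl \<le> sum c (?B - A)"
    proof -
      have "cl \<le> c y" using cost_outside[OF A, of y] yB BU by force
      also have "\<dots> \<le> sum c (?B - A)"
        using yB BU cost finB by (intro member_le_sum) auto
      finally show ?thesis .
    qed
    have split: "sum c ?B = sum c A + sum c (?B - A)"
      using sum.subset_diff[OF B(1) finB, of c] by simp
    have eq: "\<Psi> ?B - \<Psi> A = (real (g ?B) - real (g A)) - (1 - 2 * \<epsilon>) * \<tau> * sum c (?B - A)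
                - \<epsilon> * \<tau> * sum c (?B - A)"
      by (simp add: \<Psi>_def split algebra_simps)
    have less: "\<epsilon> * \<tau> * cl \<le> \<epsilon> * \<tau> * sum c (?B - A)"
      using cB eps \<tau> by (intro mult_left_mono) auto
    show ?thesis
    proof (cases "xs \<in> ?acc")
      case True
      \<comment> \<open>Sparsity caps the gain of the whole set \<open>X\<close>, hence that of any
        prefix.\<close>
      have "real (g ?B) \<le> real (g (A \<union> X))"
        using g_mono[OF B(2)] XU AU by auto
      also have "\<dots> \<le> real (g A) + (\<Sum>v\<in>X. real (mg v A))"
      proof -
        have "g (A \<union> X) \<le> g A + (\<Sum>v\<in>X. mg v A)" using AU XU by (intro g_union_le) auto
        then show ?thesis by (metis of_nat_le_iff of_nat_add of_nat_sum)
      qed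
      finally have "(1 - \<epsilon>) * (real (g ?B) - real (g A)) \<le> (1 - \<epsilon>) * (\<Sum>v\<in>X. real (mg v A))"
        using eps by (intro mult_left_mono) auto
      also have "\<dots> \<le> (\<Sum>v\<in>X. \<tau> * c v)"
        unfolding sum_distrib_left using sp XU by (intro sum_mono) (auto simp: sparse_def)
      also have "\<dots> = \<tau> * sum c X" by (simp add: sum_distrib_left)
      also have "\<dots> \<le> D" unfolding D_def using cXle \<tau> by (intro mult_left_mono) auto
      finally have *: "(1 - \<epsilon>) * (real (g ?B) - real (g A)) \<le> D" .
      have "0 \<le> (1 - 2 * \<epsilon>) * \<tau> * sum c (?B - A)"
        using eps \<tau> sum_cost_nonneg[of "?B - A"] BU by (intro mult_nonneg_nonneg) auto
      then have "\<Psi> ?B - \<Psi> A + \<epsilon> * \<tau> * cl \<le> real (g ?B) - real (g A)"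
        using eq less by linarith
      then have "(1 - \<epsilon>) * (\<Psi> ?B - \<Psi> A + \<epsilon> * \<tau> * cl) \<le> (1 - \<epsilon>) * (real (g ?B) - real (g A))"
        using eps by (intro mult_left_mono) auto
      then show ?thesis using * True by simp
    next
      case False
      then have "real (g ?B) - real (g A) < (1 - 2 * \<epsilon>) * \<tau> * sum c (?B - A)"
        by (simp add: accept_def g_def)
      then have "\<Psi> ?B - \<Psi> A + \<epsilon> * \<tau> * cl \<le> 0" using eq less by linarith
      then show ?thesis using False eps by (simp add: mult_le_0_iff)
    qed
  qed
  have "\<Psi> A \<le> measure_pmf.expectation ?p (\<lambda>xs. \<Psi> (?st xs))"
    unfolding \<Psi>_def using AU XU \<tau> by (intro expectation_stop_ge) (auto simp: X_def)
  then have "(1 - \<epsilon>) * (\<epsilon> * \<tau> * cl) \<le>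
      (1 - \<epsilon>) * (measure_pmf.expectation ?p (\<lambda>xs. \<Psi> (?st xs)) - \<Psi> A + \<epsilon> * \<tau> * cl)"
    using eps by (intro mult_left_mono) auto
  also have "\<dots> = measure_pmf.expectation ?p (\<lambda>xs. (1 - \<epsilon>) * (\<Psi> (?st xs) - \<Psi> A + \<epsilon> * \<tau> * cl))"
    by (simp add: integrable_measure_pmf_finite[OF finp])
  also have "\<dots> \<le> measure_pmf.expectation ?p (\<lambda>xs. D * indicator ?acc xs)"
    using integrable_measure_pmf_finite[OF finp] Z finX
    by (intro integral_mono_AE) (auto simp: AE_measure_pmf_iff)
  also have "\<dots> = D * measure_pmf.prob ?p ?acc" by simp
  finally have main: "\<tau> * ((1 - \<epsilon>) * \<epsilon> * cl)
      \<le> \<tau> * ((real (length us) * ch) * measure_pmf.prob ?p ?acc)"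
    by (simp add: D_def mult_ac)
  then have "(1 - \<epsilon>) * \<epsilon> * cl \<le> (real (length us) * ch) * measure_pmf.prob ?p ?acc"
    using \<tau> by simp
  moreover have "0 < real (length us) * ch" using chpos x0 XU by (cases us) auto
  ultimately show ?thesis by (simp add: field_simps)
qed

section \<open>Chains of successful batches\<close>

text \<open>
  Density at most \<open>\<tau> / (1 - \<epsilon>)\<close> is what the previous threshold leaves behind; without it a batch has
  no guaranteed success probability, so nothing is demanded then.
\<close>

definition good_step :: "real \<Rightarrow> 'a set \<Rightarrow> 'a set \<Rightarrow> bool" where
  "good_step \<tau> A B \<longleftrightarrow> admissible B \<and> A \<subseteq> B \<and>
     (sparse \<tau> A \<longrightarrow> accept f \<tau> A B \<and>
        sum c (cands f \<tau> B) \<le> (1 - \<epsilon>) * sum c (cands f \<tau> A))"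

text \<open>\<open>run\<close> records only the final set, so the intermediate sets are
  existentially quantified.\<close>

primrec chain :: "real list \<Rightarrow> 'a set \<Rightarrow> 'a set \<Rightarrow> bool" where
  "chain [] A B \<longleftrightarrow> B = A"
| "chain (\<tau> # ts) A B \<longleftrightarrow> (\<exists>A'. good_step \<tau> A A' \<and> chain ts A' B)"

lemma chain_append: "chain (ts @ ts') A B \<longleftrightarrow> (\<exists>A'. chain ts A A' \<and> chain ts' A' B)"
  by (induction ts arbitrary: A) auto

text \<open>Shrinkage holds for every permutation, so only acceptance is left to chance, and it
  fails only if \<open>L\<close> independent permutations are all rejected. From a set that is not
  sparse every step counts as good.\<close>

lemma prob_good_step:
  fixes A \<tau>
  assumes A: "admissible A" and \<tau>: "0 < \<tau>"
  defines "\<alpha> \<equiv> \<epsilon> * (1 - \<epsilon>) * cl / (real (length us) * ch)"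
    and "X \<equiv> cands f \<tau> A"
  shows "1 - (1 - \<alpha>) ^ L \<le> measure_pmf.prob (samples X)
           {xss. good_step \<tau> A (select f \<tau> (sum c X) A xss)}"
proof -
  let ?sel = "\<lambda>xss. select f \<tau> (sum c X) A xss"
  let ?good = "{xss. good_step \<tau> A (?sel xss)}"
  let ?p = "pmf_of_set (permutations_of_set X)"
  let ?G = "{xs. accept f \<tau> A (stop f \<tau> (sum c X) A xs)}"
  have finX: "finite X" by (simp add: X_def)
  have XU: "X \<subseteq> set us - A" unfolding X_def by (rule cands_subset)
  have AU: "A \<subseteq> set us" using A by (simp add: admissible_def)
  have basic: "admissible (?sel xss) \<and> A \<subseteq> ?sel xss" if "xss \<in> set_pmf (samples X)" for xss
  proof -
    have "set xs \<subseteq> X" if "xs \<in> set xss" for xs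
      using samples_set(1)[OF finX \<open>xss \<in> _\<close> that] by simp
    from select_bounds[OF this] show ?thesis
      using A XU unfolding admissible_def by blast
  qed
  have "1 - measure_pmf.prob (samples X) {xss. set xss \<inter> ?G = {}}
      \<le> measure_pmf.prob (samples X) ?good" if sp: "sparse \<tau> A"
  proof -
    have "xss \<in> ?good" if xss: "xss \<in> set_pmf (samples X)" and ne: "set xss \<inter> ?G \<noteq> {}" for xss
    proof -
      obtain xs where find: "find (\<lambda>xs. accept f \<tau> A (stop f \<tau> (sum c X) A xs)) xss = Some xs"
        using ne by (cases "find (\<lambda>xs. accept f \<tau> A (stop f \<tau> (sum c X) A xs)) xss")
          (auto simp: find_None_iff)
      then have xs: "xs \<in> set xss" "accept f \<tau> A (stop f \<tau> (sum c X) A xs)"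
        by (auto simp: find_Some_iff)
      have "set xs = X" using samples_set(1)[OF finX xss xs(1)] .
      then have "sum c (cands f \<tau> (stop f \<tau> (sum c X) A xs)) \<le> (1 - \<epsilon>) * sum c X"
        using AU XU sum_cost_nonneg[of X] by (intro stop_shrinks) (auto simp: X_def)
      moreover have "?sel xss = stop f \<tau> (sum c X) A xs" by (simp add: select_def find)
      ultimately show ?thesis using basic[OF xss] xs(2) by (simp add: good_step_def X_def)
    qed
    then have "- ?good \<inter> set_pmf (samples X) \<subseteq> {xss. set xss \<inter> ?G = {}}" by blast
    then have "measure_pmf.prob (samples X) (- ?good \<inter> set_pmf (samples X))
        \<le> measure_pmf.prob (samples X) {xss. set xss \<inter> ?G = {}}"
      by (intro measure_pmf.finite_measure_mono) auto
    then have "measure_pmf.prob (samples X) (- ?good)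
        \<le> measure_pmf.prob (samples X) {xss. set xss \<inter> ?G = {}}"
      by (simp add: measure_Int_set_pmf)
    then show ?thesis
      using measure_pmf.prob_compl[of ?good "samples X"] by (simp add: Compl_eq_Diff_UNIV)
  qed
  moreover have "measure_pmf.prob (samples X) {xss. set xss \<inter> ?G = {}} \<le> (1 - \<alpha>) ^ L"
    if "sparse \<tau> A"
    unfolding samples_def using prob_accept[OF A that \<tau>]
    by (intro prob_replicate_pmf_none) (simp add: \<alpha>_def X_def)
  moreover have "measure_pmf.prob (samples X) ?good = 1" if "\<not> sparse \<tau> A"
    using basic that by (intro measure_pmf.prob_eq_1[THEN iffD2])
      (auto simp: AE_measure_pmf_iff good_step_def)
  moreover have "0 \<le> (1 - \<alpha>) ^ L"
    using success_rate_le_1 by (simp add: \<alpha>_def)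
  ultimately show ?thesis by (cases "sparse \<tau> A") force+
qed

lemma prob_chain:
  fixes A
  assumes "admissible A" "\<forall>\<tau>\<in>set ts. 0 < \<tau>"
  defines "\<alpha> \<equiv> \<epsilon> * (1 - \<epsilon>) * cl / (real (length us) * ch)"
  shows "(1 - (1 - \<alpha>) ^ L) ^ length ts \<le>
      measure_pmf.prob (run f (loop ts A)) {B. chain ts A B}"
  using assms(1,2)
proof (induction ts arbitrary: A)
  case Nil
  then show ?case by (simp add: indicator_def)
next
  case (Cons \<tau> ts)
  let ?X = "cands f \<tau> A"
  let ?sel = "\<lambda>xss. select f \<tau> (sum c ?X) A xss"
  have nonneg: "0 \<le> 1 - (1 - \<alpha>) ^ L"
  proof -
    have "0 \<le> \<alpha>" unfolding \<alpha>_def using eps cl by simp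
    then show ?thesis using success_rate_le_1 by (simp add: \<alpha>_def power_le_one)
  qed
  have "(1 - (1 - \<alpha>) ^ L) * (1 - (1 - \<alpha>) ^ L) ^ length ts \<le>
      measure_pmf.prob (bind_pmf (samples ?X) (\<lambda>xss. run f (loop ts (?sel xss)))) {B. chain (\<tau> # ts) A B}"
  proof (rule prob_bind_pmf_ge)
    show "1 - (1 - \<alpha>) ^ L \<le> measure_pmf.prob (samples ?X) {xss. good_step \<tau> A (?sel xss)}"
      unfolding \<alpha>_def using Cons.prems by (intro prob_good_step) auto
    show "(1 - (1 - \<alpha>) ^ L) ^ length ts
        \<le> measure_pmf.prob (run f (loop ts (?sel xss))) {B. chain (\<tau> # ts) A B}"
      if "xss \<in> {xss. good_step \<tau> A (?sel xss)}" for xss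
    proof -
      have good: "good_step \<tau> A (?sel xss)" using that by simp
      then have "(1 - (1 - \<alpha>) ^ L) ^ length ts
          \<le> measure_pmf.prob (run f (loop ts (?sel xss))) {B. chain ts (?sel xss) B}"
        using Cons.prems by (intro Cons.IH) (auto simp: good_step_def)
      also have "\<dots> \<le> measure_pmf.prob (run f (loop ts (?sel xss))) {B. chain (\<tau> # ts) A B}"
        using good by (intro measure_pmf.finite_measure_mono) auto
      finally show ?thesis .
    qed
    show "0 \<le> (1 - (1 - \<alpha>) ^ L) ^ length ts" using nonneg by simp
  qed
  then show ?case by (simp only: run_loop_Cons length_Cons power_Suc)
qed

section \<open>Potential argument for the cost\<close>

text \<open>
  Upper bound on \<open>1 - 2 \<epsilon>\<close> times the final cost: the price still to be paid is \<open>(k - g A) / \<tau>\<close> at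
  the current threshold, and the rise of the price as \<open>\<tau>\<close> falls is charged harmonically to the
  elements of the cover \<open>Q\<close>.
\<close>

definition potential :: "'a set \<Rightarrow> real \<Rightarrow> 'a set \<Rightarrow> real" where
  "potential Q \<tau> A = (1 - 2 * \<epsilon>) * sum c A + (\<Sum>v\<in>Q. c v / (1 - \<epsilon>) * harm (mg v A))
     - ((\<Sum>v\<in>Q. real (mg v A)) - (real k - real (g A))) / \<tau>"

context
  fixes Q :: "'a set"
  assumes Q: "Q \<subseteq> set us" "k \<le> f Q"
begin

text \<open>Adding \<open>Q\<close> to \<open>A\<close> reaches \<open>k\<close>. So the numerator
  of the last term of \<open>potential\<close> is nonnegative, and lowering the threshold can only
  lower the potential.\<close>

lemma residual_le_sum_gain:
  assumes "A \<subseteq> set us"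
  shows "real k - real (g A) \<le> (\<Sum>v\<in>Q. real (mg v A))"
proof -
  have "k \<le> f (A \<union> Q)" using Q f_mono[of Q "A \<union> Q"] assms by auto
  then have "k = g (A \<union> Q)" by (simp add: g_def)
  also have "\<dots> \<le> g A + (\<Sum>v\<in>Q. mg v A)" using assms Q by (intro g_union_le) auto
  finally have "real k \<le> real (g A + (\<Sum>v\<in>Q. mg v A))" by (simp only: of_nat_le_iff)
  then show ?thesis by simp
qed

text \<open>Acceptance pays for the new elements at price \<open>1 / \<tau>\<close> per unit of
  residual; the loss of gain of the elements of \<open>Q\<close> at the same price is paid by the
  fall of their harmonic numbers.\<close>

lemma potential_step:
  assumes "admissible A" "sparse \<tau> A" "0 < \<tau>" "good_step \<tau> A B"
  shows "potential Q \<tau> B \<le> potential Q \<tau> A"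
proof -
  have AB: "A \<subseteq> B" "B \<subseteq> set us" and acc: "accept f \<tau> A B"
    using assms by (auto simp: good_step_def admissible_def)
  have finB: "finite B" using AB(2) finite_subset by blast
  have "(1 - 2 * \<epsilon>) * sum c (B - A) \<le> (real (g B) - real (g A)) / \<tau>"
    using acc \<open>0 < \<tau>\<close> by (simp add: accept_def g_def field_simps)
  then have price: "(1 - 2 * \<epsilon>) * sum c B \<le> (1 - 2 * \<epsilon>) * sum c A + (real (g B) - real (g A)) / \<tau>"
    using sum.subset_diff[OF AB(1) finB, of c] by (simp add: algebra_simps)
  have "(real (mg v A) - real (mg v B)) / \<tau>
      \<le> c v / (1 - \<epsilon>) * harm (mg v A) - c v / (1 - \<epsilon>) * harm (mg v B)" if v: "v \<in> Q" for v
  proof (cases "mg v A = 0")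
    case True
    then have "mg v B = 0" using mg_antimono[OF AB, of v] v Q by auto
    then show ?thesis using True by simp
  next
    case False
    let ?a = "mg v A" and ?b = "mg v B"
    have ba: "?b \<le> ?a" using mg_antimono[OF AB, of v] v Q by auto
    have "(1 - \<epsilon>) * real ?a \<le> \<tau> * c v" using assms(2) v Q by (auto simp: sparse_def)
    \<comment> \<open>Sparsity lets \<open>c v / (1 - \<epsilon>)\<close> pay for the full gain
      \<open>?a\<close>; the lost fraction of it is at most the difference of harmonic
      numbers.\<close>
    then have "real ?a / \<tau> \<le> c v / (1 - \<epsilon>)" using eps \<open>0 < \<tau>\<close> by (simp add: field_simps)
    then have "real ?a / \<tau> * (real (?a - ?b) / real ?a) \<le> c v / (1 - \<epsilon>) * (harm ?a - harm ?b)"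
      using harm_diff_ge[OF ba] False \<open>0 < \<tau>\<close> eps v Q assms
      by (intro mult_mono) (auto intro!: divide_nonneg_pos cost)
    also have "real ?a / \<tau> * (real (?a - ?b) / real ?a) = (real ?a - real ?b) / \<tau>"
      using False ba by (simp add: of_nat_diff)
    finally show ?thesis by (simp add: algebra_simps)
  qed
  then have "(\<Sum>v\<in>Q. (real (mg v A) - real (mg v B)) / \<tau>)
     \<le> (\<Sum>v\<in>Q. c v / (1 - \<epsilon>) * harm (mg v A) - c v / (1 - \<epsilon>) * harm (mg v B))"
    by (rule sum_mono)
  then have "((\<Sum>v\<in>Q. real (mg v A)) - (\<Sum>v\<in>Q. real (mg v B))) / \<tau>
     \<le> (\<Sum>v\<in>Q. c v / (1 - \<epsilon>) * harm (mg v A)) - (\<Sum>v\<in>Q. c v / (1 - \<epsilon>) * harm (mg v B))"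
    by (simp only: sum_subtractf flip: sum_divide_distrib)
  then show ?thesis using price
    unfolding potential_def diff_divide_distrib by linarith
qed

lemma potential_antimono_threshold:
  assumes "A \<subseteq> set us" "0 < \<tau>'" "\<tau>' \<le> \<tau>"
  shows "potential Q \<tau>' A \<le> potential Q \<tau> A"
  unfolding potential_def using residual_le_sum_gain[OF assms(1)] assms
  by (intro diff_left_mono divide_left_mono) auto

lemma chain_replicate:
  assumes "chain (replicate n \<tau>) A B" "admissible A" "sparse \<tau> A" "0 < \<tau>"
  shows "admissible B \<and> sparse \<tau> B \<and> potential Q \<tau> B \<le> potential Q \<tau> A
    \<and> sum c (cands f \<tau> B) \<le> (1 - \<epsilon>) ^ n * sum c (cands f \<tau> A)"
  using assms
proof (induction n arbitrary: A)
  case (Suc n)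
  then obtain A' where A': "good_step \<tau> A A'" "chain (replicate n \<tau>) A' B" by auto
  have admissible': "admissible A'" and sp': "sparse \<tau> A'"
    and shrink: "sum c (cands f \<tau> A') \<le> (1 - \<epsilon>) * sum c (cands f \<tau> A)"
    using A' Suc.prems sparse_antimono[of \<tau> A A'] by (auto simp: good_step_def admissible_def)
  have IH: "admissible B \<and> sparse \<tau> B \<and> potential Q \<tau> B \<le> potential Q \<tau> A'
    \<and> sum c (cands f \<tau> B) \<le> (1 - \<epsilon>) ^ n * sum c (cands f \<tau> A')"
    using Suc.IH[OF A'(2) admissible' sp' Suc.prems(4)] .
  have "(1 - \<epsilon>) ^ n * sum c (cands f \<tau> A') \<le> (1 - \<epsilon>) ^ n * ((1 - \<epsilon>) * sum c (cands f \<tau> A))"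
    using shrink eps by (intro mult_left_mono) auto
  then show ?case
    using IH potential_step[OF Suc.prems(2,3,4) A'(1)] by (auto simp: mult_ac)
qed simp

text \<open>After \<open>n\<close> batches the candidates together cost at most \<open>cl\<close>,
  but each single one outside an admissible set costs more. So none is left, which is sparsity for
  the next threshold.\<close>

lemma chain_level:
  assumes "chain (replicate n \<tau>) A B" "admissible A" "sparse \<tau> A" "0 < \<tau>"
    and n: "(1 - \<epsilon>) ^ n * (real (length us) * ch) \<le> cl"
  shows "admissible B \<and> sparse ((1 - \<epsilon>) * \<tau>) B \<and> potential Q ((1 - \<epsilon>) * \<tau>) B \<le> potential Q \<tau> A"
proof -
  have B: "admissible B" "potential Q \<tau> B \<le> potential Q \<tau> A"
      "sum c (cands f \<tau> B) \<le> (1 - \<epsilon>) ^ n * sum c (cands f \<tau> A)"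
    using chain_replicate[OF assms(1-4)] by auto
  have "sum c (cands f \<tau> A) \<le> (\<Sum>v\<in>cands f \<tau> A. ch)"
    using cost by (intro sum_mono) (auto simp: cands_def)
  also have "\<dots> = real (card (cands f \<tau> A)) * ch" by simp
  also have "\<dots> \<le> real (length us) * ch"
  proof -
    have "card (cands f \<tau> A) \<le> card (set us)" using cands_subset by (intro card_mono) auto
    also have "\<dots> \<le> length us" by (rule card_length)
    finally show ?thesis using cl by simp
  qed
  finally have "(1 - \<epsilon>) ^ n * sum c (cands f \<tau> A) \<le> (1 - \<epsilon>) ^ n * (real (length us) * ch)"
    using eps by (intro mult_left_mono) auto
  then have le: "sum c (cands f \<tau> B) \<le> cl" using B(3) n by linarith
  have none: "v \<notin> cands f \<tau> B" for v
  proof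
    assume v: "v \<in> cands f \<tau> B"
    then have "cl < c v" using cost_outside[OF B(1)] by (auto simp: cands_def)
    also have "\<dots> \<le> sum c (cands f \<tau> B)"
      using v cost by (intro member_le_sum) (auto simp: cands_def)
    finally show False using le by simp
  qed
  have "(1 - \<epsilon>) * real (mg v B) \<le> (1 - \<epsilon>) * \<tau> * c v" if v: "v \<in> set us" for v
  proof (cases "v \<in> B")
    case True
    then show ?thesis using v cost eps \<open>0 < \<tau>\<close> by (simp add: mg_in)
  next
    case False
    then have "real (mg v B) \<le> \<tau> * c v" using none[of v] v by (auto simp: cands_def)
    then show ?thesis using eps by (simp add: mult.assoc)
  qed
  then have "sparse ((1 - \<epsilon>) * \<tau>) B" by (simp add: sparse_def)
  moreover have "potential Q ((1 - \<epsilon>) * \<tau>) B \<le> potential Q \<tau> B"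
    using B(1) eps \<open>0 < \<tau>\<close>
    by (intro potential_antimono_threshold) (auto simp: admissible_def algebra_simps)
  ultimately show ?thesis using B by auto
qed

lemma chain_levels:
  assumes "chain (levels n j \<tau>) A B" "admissible A" "sparse \<tau> A" "0 < \<tau>"
    and n: "(1 - \<epsilon>) ^ n * (real (length us) * ch) \<le> cl"
  shows "admissible B \<and> sparse ((1 - \<epsilon>) ^ j * \<tau>) B
    \<and> potential Q ((1 - \<epsilon>) ^ j * \<tau>) B \<le> potential Q \<tau> A"
  using assms(1-4)
proof (induction j arbitrary: A \<tau>)
  case (Suc j)
  then obtain A' where A': "chain (replicate n \<tau>) A A'" "chain (levels n j ((1 - \<epsilon>) * \<tau>)) A' B"
    by (auto simp: chain_append)
  have A'2: "admissible A'" "sparse ((1 - \<epsilon>) * \<tau>) A'"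
      "potential Q ((1 - \<epsilon>) * \<tau>) A' \<le> potential Q \<tau> A"
    using chain_level[OF A'(1) Suc.prems(2-4) n] by auto
  have "0 < (1 - \<epsilon>) * \<tau>" using eps Suc.prems by simp
  from Suc.IH[OF A'(2) A'2(1,2) this] A'2(3) show ?case by (auto simp: mult_ac)
qed simp

text \<open>The initial threshold makes \<open>cheap\<close> sparse, as gains are at most
  \<open>k\<close> and costs outside exceed \<open>cl\<close>. The potential then compares the final
  cost with the harmonic sum over \<open>Q\<close>.\<close>

lemma cover_cost_le:
  fixes n :: nat
  defines "\<tau> \<equiv> (1 - \<epsilon>) * real k / cl"
  assumes ch: "chain (levels n n \<tau>) cheap B" and k: "0 < k"
    and n: "(1 - \<epsilon>) ^ n * (real (length us) * ch) \<le> cl" "(1 - \<epsilon>) ^ n * (real k * ch) < cl"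
    and h: "\<And>v. v \<in> Q \<Longrightarrow> min (f {v}) k \<le> h"
  shows "B \<subseteq> set us \<and> k \<le> f B \<and>
    (1 - 2 * \<epsilon>) * (sum c B - sum c cheap) \<le> harm h / (1 - \<epsilon>) * sum c Q"
proof -
  have adm: "admissible cheap" by (auto simp: admissible_def cheap_def)
  have \<tau>: "0 < \<tau>" using eps k cl by (simp add: \<tau>_def)
  have "(1 - \<epsilon>) * real (mg v cheap) \<le> \<tau> * c v" if v: "v \<in> set us" for v
  proof (cases "v \<in> cheap")
    case True
    then show ?thesis using v cost \<tau> by (simp add: mg_in)
  next
    case False
    have "(1 - \<epsilon>) * real (mg v cheap) \<le> (1 - \<epsilon>) * real k"
      using eps by (intro mult_left_mono) (auto simp: gain_def)
    also have "\<dots> = \<tau> * cl" using cl by (simp add: \<tau>_def)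
    also have "\<dots> \<le> \<tau> * c v" using False v \<tau> by (intro mult_left_mono) (auto simp: cheap_def)
    finally show ?thesis .
  qed
  then have "sparse \<tau> cheap" by (simp add: sparse_def)
  from chain_levels[OF ch adm this \<tau> n(1)]
  have B: "admissible B" "sparse ((1 - \<epsilon>) ^ n * \<tau>) B"
      "potential Q ((1 - \<epsilon>) ^ n * \<tau>) B \<le> potential Q \<tau> cheap" by auto
  have BU: "B \<subseteq> set us" using B(1) by (simp add: admissible_def)
  \<comment> \<open>The last threshold forces every gain below 1; gains are integers, so they vanish
    and the truncated value has reached \<open>k\<close>.\<close>
  have zero: "mg v B = 0" if v: "v \<in> set us" for v
  proof -
    have "(1 - \<epsilon>) * real (mg v B) \<le> (1 - \<epsilon>) ^ n * \<tau> * c v"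
      using B(2) v by (simp add: sparse_def)
    also have "\<dots> \<le> (1 - \<epsilon>) ^ n * \<tau> * ch" using v cost eps \<tau> by (intro mult_left_mono) auto
    also have "\<dots> = (1 - \<epsilon>) * ((1 - \<epsilon>) ^ n * (real k * ch) / cl)" by (simp add: \<tau>_def)
    also have "\<dots> < (1 - \<epsilon>) * 1" using n(2) eps cl by (intro mult_strict_left_mono) auto
    finally have "real (mg v B) < 1" using eps by simp
    then show ?thesis by simp
  qed
  have "g (B \<union> set us) \<le> g B + (\<Sum>v\<in>set us. mg v B)" using BU by (intro g_union_le) auto
  then have gB: "g B = k" using zero BU g_univ g_le[of B] by (simp add: Un_absorb1)
  then have feas: "k \<le> f B" by (auto simp: g_def min_def split: if_splits)
  have zeroQ: "mg v B = 0" if "v \<in> Q" for v using zero that Q by auto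
  \<comment> \<open>With no residual and no gains left, only the cost term of the potential
    survives.\<close>
  have "(1 - 2 * \<epsilon>) * sum c B = potential Q ((1 - \<epsilon>) ^ n * \<tau>) B"
    using gB zeroQ by (simp add: potential_def harm_def)
  also note B(3)
  also have "potential Q \<tau> cheap
      \<le> (1 - 2 * \<epsilon>) * sum c cheap + (\<Sum>v\<in>Q. c v / (1 - \<epsilon>) * harm (mg v cheap))"
    using residual_le_sum_gain[of cheap] adm \<tau> by (simp add: potential_def admissible_def)
  also have "(\<Sum>v\<in>Q. c v / (1 - \<epsilon>) * harm (mg v cheap)) \<le> (\<Sum>v\<in>Q. c v / (1 - \<epsilon>) * harm h)"
  proof (intro sum_mono mult_left_mono)
    fix v assume v: "v \<in> Q"
    have "mg v cheap \<le> mg v {}" using v Q adm by (intro mg_antimono) (auto simp: admissible_def)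
    also have "\<dots> \<le> h" using h[OF v] by (simp add: gain_def)
    finally show "(harm (mg v cheap) :: real) \<le> harm h" by (rule harm_mono)
    show "0 \<le> c v / (1 - \<epsilon>)" using v Q cost eps by auto
  qed
  also have "(\<Sum>v\<in>Q. c v / (1 - \<epsilon>) * harm h) = harm h / (1 - \<epsilon>) * sum c Q"
    by (simp add: sum_distrib_left sum_distrib_right mult_ac sum_divide_distrib)
  finally show ?thesis using BU feas by (simp add: algebra_simps)
qed

end

lemma length_levels: "length (levels n j \<tau>) = n * j"
  by (induction j arbitrary: \<tau>) auto

lemma levels_pos: "0 < \<tau> \<Longrightarrow> t \<in> set (levels n j \<tau>) \<Longrightarrow> 0 < t"
proof (induction j arbitrary: \<tau>)
  case (Suc j)
  have "0 < (1 - \<epsilon>) * \<tau>" using eps Suc.prems by simp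
  then show ?case using Suc by (auto split: if_splits)
qed simp

end

section \<open>Numerical bounds on iterations, trials, rounds and queries\<close>

text \<open>
  Used both as the number of thresholds and as the number of batches per threshold; one logarithm
  of \<open>k m\<^sup>3 / \<epsilon>\<close> suffices for the two.
\<close>

definition iterations :: "real \<Rightarrow> nat \<Rightarrow> nat \<Rightarrow> nat" where
  "iterations \<epsilon> m k = nat \<lceil>ln (real k * real m ^ 3 / \<epsilon>) / \<epsilon>\<rceil>"

text \<open>With \<open>N = iterations \<epsilon> m k\<close> there are \<open>N ^ 2\<close>
  batches, and a permutation is accepted with probability at least
  \<open>\<epsilon> ^ 2 / (2 * real m ^ 3)\<close>. This many permutations make the expected number
  of accepted ones at least \<open>N ^ 2 / \<epsilon>\<close>.\<close>

definition trials :: "real \<Rightarrow> nat \<Rightarrow> nat \<Rightarrow> nat" where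
  "trials \<epsilon> m k = nat \<lceil>2 * real (iterations \<epsilon> m k) ^ 2 * real m ^ 3 / \<epsilon> ^ 3\<rceil>"

lemma one_minus_power_le_exp:
  fixes x :: real
  assumes "x \<le> 1"
  shows "(1 - x) ^ n \<le> exp (- (x * real n))"
proof -
  have "(1 - x) ^ n \<le> exp (- x) ^ n"
    using assms exp_ge_add_one_self[of "- x"] by (intro power_mono) auto
  then show ?thesis by (simp add: exp_of_nat_mult[symmetric] mult.commute)
qed

context
  fixes \<epsilon> :: real and m k :: nat
  assumes eps: "0 < \<epsilon>" "\<epsilon> < 1 / 5" and m: "2 \<le> m" and k: "2 \<le> k"
begin

lemma iteration_argument_gt: "5 < real k * real m ^ 3 / \<epsilon>"
proof -
  have "1 * 1 \<le> real k * real m ^ 3" using m k by (intro mult_mono) auto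
  moreover have "5 * \<epsilon> < 1" using eps by simp
  ultimately have "5 * \<epsilon> < real k * real m ^ 3" by linarith
  then show ?thesis using eps by (simp add: field_simps)
qed

lemma iterations_ge: "ln (real k * real m ^ 3 / \<epsilon>) \<le> \<epsilon> * real (iterations \<epsilon> m k)"
proof -
  have "ln (real k * real m ^ 3 / \<epsilon>) / \<epsilon> \<le> real (iterations \<epsilon> m k)"
    unfolding iterations_def by linarith
  then show ?thesis using eps by (simp add: field_simps)
qed

lemma iterations_pos: "0 < iterations \<epsilon> m k"
proof -
  have "0 < ln (real k * real m ^ 3 / \<epsilon>)" using iteration_argument_gt by (intro ln_gt_zero) auto
  then have "0 < \<epsilon> * real (iterations \<epsilon> m k)" using iterations_ge by linarith
  then show ?thesis using eps by (simp add: zero_less_mult_iff)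
qed

lemma power_iterations_le: "(1 - \<epsilon>) ^ iterations \<epsilon> m k \<le> \<epsilon> / (real k * real m ^ 3)"
proof -
  have "(1 - \<epsilon>) ^ iterations \<epsilon> m k \<le> exp (- (\<epsilon> * real (iterations \<epsilon> m k)))"
    using eps by (intro one_minus_power_le_exp) auto
  also have "\<dots> \<le> exp (- ln (real k * real m ^ 3 / \<epsilon>))" using iterations_ge by simp
  also have "\<dots> = \<epsilon> / (real k * real m ^ 3)"
    using iteration_argument_gt by (subst exp_minus, subst exp_ln) auto
  finally show ?thesis .
qed

lemma ln_bounds: "2 / 3 \<le> ln (real k)" "2 / 3 \<le> ln (real m)"
    "ln (real k * real m) = ln (real k) + ln (real m)"
proof -
  have "ln 2 \<le> ln (real k)" "ln 2 \<le> ln (real m)" using m k by simp_all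
  then show "2 / 3 \<le> ln (real k)" "2 / 3 \<le> ln (real m)" using ln2_ge_two_thirds by linarith+
  show "ln (real k * real m) = ln (real k) + ln (real m)" using m k by (intro ln_mult_pos) auto
qed

lemma iterations_le: "real (iterations \<epsilon> m k) \<le> 5 * ln (real k * real m) / \<epsilon> ^ 2"
proof -
  let ?x = "ln (real k)" and ?y = "ln (real m)"
  have pos: "0 < real k" "0 < real m ^ 3" using m k by simp_all
  have "ln (real k * real m ^ 3 / \<epsilon>) = ?x + 3 * ?y + ln (1 / \<epsilon>)"
    using m pos eps by (simp add: ln_div ln_mult_pos ln_realpow)
  \<comment> \<open>This crude estimate costs the second factor \<open>1 / \<epsilon>\<close>;
    squaring then gives exactly the fourth power in the round bound.\<close>
  also have "ln (1 / \<epsilon>) \<le> 1 / \<epsilon>" using eps ln_le_minus_one[of "1 / \<epsilon>"] by simp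
  finally have arg: "ln (real k * real m ^ 3 / \<epsilon>) \<le> ?x + 3 * ?y + 1 / \<epsilon>" by simp
  have "0 < ln (real k * real m ^ 3 / \<epsilon>)" using iteration_argument_gt by (intro ln_gt_zero) auto
  then have "0 < ln (real k * real m ^ 3 / \<epsilon>) / \<epsilon>" using eps by simp
  then have "real (iterations \<epsilon> m k) \<le> ln (real k * real m ^ 3 / \<epsilon>) / \<epsilon> + 1"
    unfolding iterations_def by linarith
  also have "\<dots> \<le> (?x + 3 * ?y + 1 / \<epsilon>) / \<epsilon> + 1"
    using arg eps by (simp add: divide_right_mono)
  also have "\<dots> = (\<epsilon> * (?x + 3 * ?y) + 1 + \<epsilon> ^ 2) / \<epsilon> ^ 2"
    using eps by (simp add: field_simps power2_eq_square)
  also have "\<dots> \<le> 5 * (?x + ?y) / \<epsilon> ^ 2"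
  proof (rule divide_right_mono)
    have "\<epsilon> * (?x + 3 * ?y) \<le> 1 * (?x + 3 * ?y)"
      using eps ln_bounds by (intro mult_right_mono) auto
    moreover have "\<epsilon> ^ 2 \<le> 1" using eps by (intro power_le_one) auto
    ultimately have "\<epsilon> * (?x + 3 * ?y) + 1 + \<epsilon> ^ 2 \<le> (1 * (?x + 3 * ?y) + 1) + 1"
      by (intro add_mono) auto
    also have "\<dots> \<le> 5 * (?x + ?y)" using ln_bounds(1,2) by simp
    finally show "\<epsilon> * (?x + 3 * ?y) + 1 + \<epsilon> ^ 2 \<le> 5 * (?x + ?y)" .
  qed simp
  finally show ?thesis using ln_bounds(3) by simp
qed

lemma rounds_le: "real (1 + 2 * iterations \<epsilon> m k ^ 2) \<le> 201 * round_bound \<epsilon> m k"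
proof -
  let ?x = "ln (real k)" and ?y = "ln (real m)" and ?N = "real (iterations \<epsilon> m k)"
  let ?z = "ln (ln (real m * real k))"
  let ?E = "ln (real k * real m) * ln (real k) * (?y + ?z) / \<epsilon> ^ 4"
  have z: "0 \<le> ?z"
    using ln_bounds by (intro ln_ge_zero) (simp add: mult.commute)
  \<comment> \<open>Both logarithms exceed 1/2, so their sum is at most four times their product.
    This trades one factor \<open>ln (real k * real m)\<close> for \<open>ln (real k)\<close> times
    \<open>ln (real m)\<close>.\<close>
  have sq: "(?x + ?y) \<le> 4 * (?x * ?y)"
  proof -
    have "0 \<le> ?x * (2 * ?y - 1) + ?y * (2 * ?x - 1)"
      using ln_bounds by (intro add_nonneg_nonneg mult_nonneg_nonneg) auto
    then show ?thesis by (simp add: algebra_simps)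
  qed
  have "?N ^ 2 \<le> (5 * ln (real k * real m) / \<epsilon> ^ 2) ^ 2"
    using iterations_le by (intro power_mono) auto
  also have "\<dots> = 25 * ((?x + ?y) * (?x + ?y)) / \<epsilon> ^ 4"
    using ln_bounds(3) by (simp add: power2_eq_square power4_eq_xxxx field_simps)
  also have "\<dots> \<le> 25 * ((?x + ?y) * (4 * (?x * (?y + ?z)))) / \<epsilon> ^ 4"
  proof (intro divide_right_mono mult_left_mono)
    have "?x * ?y \<le> ?x * (?y + ?z)" using ln_bounds z by (intro mult_left_mono) auto
    then show "?x + ?y \<le> 4 * (?x * (?y + ?z))" using sq by linarith
  qed (use ln_bounds in auto)
  also have "\<dots> = 100 * ?E" by (simp add: ln_bounds(3))
  finally have "1 + 2 * ?N ^ 2 \<le> 1 + 200 * ?E" by linarith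
  also have "\<dots> \<le> 201 * max 1 ?E" by linarith
  finally show ?thesis by (simp add: round_bound_def)
qed

lemma trials_ge: "2 * real (iterations \<epsilon> m k) ^ 2 * real m ^ 3 / \<epsilon> ^ 3 \<le> real (trials \<epsilon> m k)"
  unfolding trials_def by linarith

lemma trials_pos: "1 \<le> trials \<epsilon> m k"
proof -
  have "0 < 2 * real (iterations \<epsilon> m k) ^ 2 * real m ^ 3 / \<epsilon> ^ 3"
    using iterations_pos m eps by simp
  then have "0 < real (trials \<epsilon> m k)" using trials_ge by linarith
  then show ?thesis by simp
qed

text \<open>One batch fails with probability at most the exponential of
  \<open>- (N ^ 2 / \<epsilon>)\<close>, hence at most \<open>\<epsilon> / N ^ 2\<close>, where
  \<open>N\<close> is the number of iterations. Bernoulli's inequality adds this up over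
  \<open>N ^ 2\<close> batches.\<close>

lemma trials_failure_le:
  assumes "\<epsilon> ^ 2 / (2 * real m ^ 3) \<le> \<alpha>" "\<alpha> \<le> 1"
  shows "1 - \<epsilon> \<le> (1 - (1 - \<alpha>) ^ trials \<epsilon> m k) ^ (iterations \<epsilon> m k ^ 2)"
proof -
  let ?N = "real (iterations \<epsilon> m k) ^ 2"
  have N: "0 < ?N" using iterations_pos by simp
  have \<alpha>: "0 \<le> \<alpha>" using assms(1) eps by (rule_tac order_trans[OF _ assms(1)]) simp
  have "?N / \<epsilon> = \<epsilon> ^ 2 / (2 * real m ^ 3) * (2 * ?N * real m ^ 3 / \<epsilon> ^ 3)"
    using eps m by (simp add: power2_eq_square power3_eq_cube)
  also have "\<dots> \<le> \<alpha> * real (trials \<epsilon> m k)"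
    using assms(1) trials_ge \<alpha> eps by (intro mult_mono) auto
  finally have "?N / \<epsilon> \<le> \<alpha> * real (trials \<epsilon> m k)" .
  moreover have "(1 - \<alpha>) ^ trials \<epsilon> m k \<le> exp (- (\<alpha> * real (trials \<epsilon> m k)))"
    using assms(2) by (rule one_minus_power_le_exp)
  ultimately have "(1 - \<alpha>) ^ trials \<epsilon> m k \<le> exp (- (?N / \<epsilon>))"
    by (meson exp_le_cancel_iff neg_le_iff_le order_trans)
  also have "\<dots> \<le> 1 / (?N / \<epsilon>)"
  proof -
    have "?N / \<epsilon> \<le> exp (?N / \<epsilon>)" using exp_ge_add_one_self[of "?N / \<epsilon>"] by linarith
    then have "inverse (exp (?N / \<epsilon>)) \<le> inverse (?N / \<epsilon>)"
      using N eps by (intro le_imp_inverse_le) auto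
    then show ?thesis by (simp add: exp_minus inverse_eq_divide)
  qed
  finally have "?N * (1 - \<alpha>) ^ trials \<epsilon> m k \<le> \<epsilon>" using N by (simp add: field_simps)
  moreover have "1 + real (iterations \<epsilon> m k ^ 2) * (- ((1 - \<alpha>) ^ trials \<epsilon> m k))
      \<le> (1 + - ((1 - \<alpha>) ^ trials \<epsilon> m k)) ^ (iterations \<epsilon> m k ^ 2)"
    using \<alpha> assms(2) by (intro Bernoulli_inequality) (simp add: power_le_one)
  ultimately show ?thesis by simp
qed

lemma queries_le:
  "real (trials \<epsilon> m k * (m + 1) ^ 2) \<le> 204 * (real m + ln (real k) + 1 / \<epsilon>) ^ 14"
proof -
  \<comment> \<open>\<open>s\<close> dominates \<open>m\<close>, \<open>1 / \<epsilon>\<close> and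
    the logarithm. The iterations are at most \<open>5 * s ^ 3\<close>, the trials at most
    \<open>51 * s ^ 12\<close> and \<open>(m + 1) ^ 2\<close> at most \<open>4 * s ^ 2\<close>,
    whence 204 and 14.\<close>
  define s where "s = real m + ln (real k) + 1 / \<epsilon>"
  let ?N = "real (iterations \<epsilon> m k)"
  have inv: "1 / \<epsilon> \<le> s" "real m \<le> s" using ln_bounds eps by (simp_all add: s_def)
  have "5 \<le> 1 / \<epsilon>" using eps by (simp add: field_simps)
  then have s1: "1 \<le> s" using inv by linarith
  have "ln (real m) \<le> real m" using ln_le_minus_one[of "real m"] m by simp
  moreover have "0 \<le> 1 / \<epsilon>" using eps by simp
  ultimately have ln_s: "ln (real k * real m) \<le> s" unfolding s_def ln_bounds(3) by linarith
  have "?N \<le> 5 * (ln (real k * real m) * (1 / \<epsilon>) ^ 2)"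
    using iterations_le by (simp add: field_simps)
  also have "\<dots> \<le> 5 * (s * s ^ 2)"
    using ln_s inv eps s1 by (intro mult_left_mono mult_mono power_mono) auto
  finally have N: "?N \<le> 5 * s ^ 3" by (simp add: power2_eq_square power3_eq_cube)
  have "2 * ?N ^ 2 * real m ^ 3 / \<epsilon> ^ 3 = 2 * ?N ^ 2 * (real m ^ 3 * (1 / \<epsilon>) ^ 3)"
    by (simp add: field_simps)
  also have "\<dots> \<le> 2 * (5 * s ^ 3) ^ 2 * (s ^ 3 * s ^ 3)"
    using N inv eps s1 by (intro mult_mono power_mono mult_nonneg_nonneg) auto
  also have "\<dots> = 50 * s ^ 12" by (simp add: power_mult_distrib flip: power_mult power_add)
  finally have T: "2 * ?N ^ 2 * real m ^ 3 / \<epsilon> ^ 3 \<le> 50 * s ^ 12" .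
  have "0 \<le> 2 * ?N ^ 2 * real m ^ 3 / \<epsilon> ^ 3" using eps by simp
  then have "real (trials \<epsilon> m k) \<le> 2 * ?N ^ 2 * real m ^ 3 / \<epsilon> ^ 3 + 1"
    unfolding trials_def by linarith
  moreover have "1 \<le> s ^ 12" using s1 by (rule one_le_power)
  ultimately have "real (trials \<epsilon> m k) \<le> 51 * s ^ 12" using T by linarith
  moreover have "(real m + 1) ^ 2 \<le> (2 * s) ^ 2" using inv s1 by (intro power_mono) auto
  ultimately have "real (trials \<epsilon> m k) * (real m + 1) ^ 2 \<le> 51 * s ^ 12 * (2 * s) ^ 2"
    using s1 by (intro mult_mono) auto
  also have "\<dots> = 204 * s ^ 14" by (simp add: power_mult_distrib flip: power_add)
  finally show ?thesis by (simp add: s_def add.commute)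
qed

end

text \<open>Here \<open>x\<close> is the cost of the free elements and \<open>y\<close> the total
  cost. The two losses combine to \<open>1 / (1 - 3 * \<epsilon>)\<close>, and
  \<open>1 \<le> h\<close> turns the free part into a further summand \<epsilon>; the passage to
  \<open>1 - 5 * \<epsilon>\<close> has room for twice that.\<close>

lemma approximation_slack:
  fixes \<epsilon> h opt x y :: real
  assumes "0 < \<epsilon>" "\<epsilon> < 1 / 5" "1 \<le> h" "0 \<le> opt" "x \<le> \<epsilon> * opt"
    and "(1 - 2 * \<epsilon>) * (y - x) \<le> h / (1 - \<epsilon>) * opt"
  shows "y \<le> h / (1 - 5 * \<epsilon>) * opt"
proof -
  have "(1 - 3 * \<epsilon>) \<le> (1 - 2 * \<epsilon>) * (1 - \<epsilon>)" by (simp add: algebra_simps)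
  then have "1 / ((1 - 2 * \<epsilon>) * (1 - \<epsilon>)) \<le> 1 / (1 - 3 * \<epsilon>)"
    using assms by (intro divide_left_mono) auto
  then have *: "h * opt * (1 / ((1 - 2 * \<epsilon>) * (1 - \<epsilon>))) \<le> h * opt * (1 / (1 - 3 * \<epsilon>))"
    using assms by (intro mult_left_mono) auto
  have "(1 - \<epsilon>) * ((1 - 2 * \<epsilon>) * (y - x)) \<le> (1 - \<epsilon>) * (h / (1 - \<epsilon>) * opt)"
    using assms by (intro mult_left_mono) auto
  also have "\<dots> = h * opt" using assms by simp
  finally have "(1 - 2 * \<epsilon>) * (1 - \<epsilon>) * (y - x) \<le> h * opt" by (simp add: mult_ac)
  moreover have "0 < (1 - 2 * \<epsilon>) * (1 - \<epsilon>)" using assms by simp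
  ultimately have "y - x \<le> h * opt * (1 / ((1 - 2 * \<epsilon>) * (1 - \<epsilon>)))"
    by (simp add: pos_le_divide_eq mult.commute)
  then have "y - x \<le> h * opt * (1 / (1 - 3 * \<epsilon>))" using * by linarith
  moreover have "x \<le> h * opt * \<epsilon>"
  proof -
    have "1 * (\<epsilon> * opt) \<le> h * (\<epsilon> * opt)" using assms by (intro mult_right_mono) auto
    also have "h * (\<epsilon> * opt) = h * opt * \<epsilon>" by simp
    finally show ?thesis using assms by linarith
  qed
  ultimately have "y \<le> h * opt * (1 / (1 - 3 * \<epsilon>) + \<epsilon>)" by (simp add: algebra_simps)
  also have "\<dots> \<le> h * opt * (1 / (1 - 5 * \<epsilon>))"
  proof (rule mult_left_mono)
    have "1 / (1 - 5 * \<epsilon>) - 1 / (1 - 3 * \<epsilon>) = 2 * \<epsilon> / ((1 - 5 * \<epsilon>) * (1 - 3 * \<epsilon>))"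
      using assms by (simp add: field_simps)
    also have "\<dots> \<ge> 2 * \<epsilon> / 1"
      using assms by (intro divide_left_mono mult_le_one) auto
    finally show "1 / (1 - 3 * \<epsilon>) + \<epsilon> \<le> 1 / (1 - 5 * \<epsilon>)" using assms by simp
  qed (use assms in auto)
  finally show ?thesis by (simp add: mult_ac)
qed

section \<open>The covering algorithm\<close>

definition elements :: "'a set \<Rightarrow> 'a list" where
  "elements V = (SOME us. set us = V \<and> distinct us)"

lemma elements:
  assumes "finite V"
  shows "set (elements V) = V" "distinct (elements V)"
  using someI_ex[OF finite_distinct_list[OF assms]] by (auto simp: elements_def)

text \<open>The level sets of \<open>c\<close> change only at values of \<open>c\<close>, so one
  batch of queries suffices. The value 0 also accounts for covers that are empty or free.\<close>

definition budget :: "'a set \<Rightarrow> ('a set \<Rightarrow> nat) \<Rightarrow> ('a \<Rightarrow> real) \<Rightarrow> nat \<Rightarrow> real" where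
  "budget V F c k = Min {b \<in> insert 0 (c ` V). k \<le> F {v \<in> V. c v \<le> b}}"

definition cheapest_singleton :: "'a set \<Rightarrow> ('a set \<Rightarrow> nat) \<Rightarrow> ('a \<Rightarrow> real) \<Rightarrow> nat \<Rightarrow> 'a set" where
  "cheapest_singleton V F c k =
     (if k \<le> F {} then {} else {arg_min_on c {v \<in> V. k \<le> F {v}}})"

definition budget_cover :: "real \<Rightarrow> 'a set \<Rightarrow> ('a \<Rightarrow> real) \<Rightarrow> nat \<Rightarrow> real \<Rightarrow> 'a oracle_alg" where
  "budget_cover \<epsilon> V c k B =
     (let m = card V; n = iterations \<epsilon> m k; cl = \<epsilon> * B / real m;
          us = filter (\<lambda>v. c v \<le> real m * B) (elements V)
      in batch_greedy.loop us c k \<epsilon> (trials \<epsilon> m k)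
           (batch_greedy.levels \<epsilon> n n ((1 - \<epsilon>) * real k / cl)) {v \<in> set us. c v \<le> cl})"

text \<open>
  For \<open>k = 1\<close> or at most one element the round bound is a constant, but there some optimal cover has
  at most one element.
\<close>

definition cover_alg :: "real \<Rightarrow> 'a set \<Rightarrow> ('a \<Rightarrow> real) \<Rightarrow> nat \<Rightarrow> 'a oracle_alg" where
  "cover_alg \<epsilon> V c k =
     (if card V \<le> 1 \<or> k = 1
      then ask ({} # map (\<lambda>v. {v}) (elements V)) (\<lambda>F. Output (cheapest_singleton V F c k))
      else ask (map (\<lambda>b. {v \<in> V. c v \<le> b}) (0 # map c (elements V))) (\<lambda>F.
        let B = budget V F c k
        in if B = 0 then Output {v \<in> V. c v \<le> 0} else budget_cover \<epsilon> V c k B))"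

section \<open>Optimal cost, budget and correctness of the algorithm\<close>

lemma min_cover_cost_attained:
  assumes "finite V" "k \<le> f V"
  obtains Q where "Q \<subseteq> V" "k \<le> f Q" "sum c Q = min_cover_cost V f c k"
proof -
  have "finite {A. A \<subseteq> V \<and> k \<le> f A}" using assms(1) by simp
  moreover have "V \<in> {A. A \<subseteq> V \<and> k \<le> f A}" using assms(2) by simp
  ultimately have "min_cover_cost V f c k \<in> sum c ` {A. A \<subseteq> V \<and> k \<le> f A}"
    unfolding min_cover_cost_def by (intro Min_in) auto
  then show thesis using that by auto
qed

lemma min_cover_cost_le:
  assumes "finite V" "A \<subseteq> V" "k \<le> f A"
  shows "min_cover_cost V f c k \<le> sum c A"
  unfolding min_cover_cost_def using assms by (intro Min_le) auto

context
  fixes V :: "'a set" and f :: "'a set \<Rightarrow> nat" and c :: "'a \<Rightarrow> real" and k :: nat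
  assumes fin: "finite V" and submod: "submodular_on V f" and mono: "mono_on (Pow V) f"
    and nonneg: "\<forall>v\<in>V. 0 \<le> c v" and k: "0 < k" and coverable: "k \<le> f V"
begin

lemma min_cover_cost_nonneg: "0 \<le> min_cover_cost V f c k"
proof -
  obtain Q where "Q \<subseteq> V" "sum c Q = min_cover_cost V f c k"
    using min_cover_cost_attained[where f = f and c = c, OF fin coverable] by blast
  then show ?thesis using nonneg sum_nonneg[of Q c] by auto
qed

lemma ex_singleton_pos:
  assumes "A \<subseteq> V" "A \<noteq> {}" "0 < f A"
  shows "\<exists>v\<in>A. 0 < f {v}"
proof (rule ccontr)
  assume "\<not> ?thesis"
  then have "(\<Sum>v\<in>A. f {v}) = 0" by simp
  moreover have "f A \<le> (\<Sum>v\<in>A. f {v})"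
    using submod assms fin finite_subset by (intro submodular_le_sum_singletons) auto
  ultimately show False using assms by simp
qed

lemma harm_ge_1:
  assumes "V \<noteq> {}"
  shows "(1 :: real) \<le> harm (min (Max ((\<lambda>v. f {v}) ` V)) k)"
proof -
  obtain v where v: "v \<in> V" "0 < f {v}" using ex_singleton_pos[of V] assms coverable k by auto
  have "f {v} \<le> Max ((\<lambda>v. f {v}) ` V)" using v fin by (intro Max_ge) auto
  then have "1 \<le> min (Max ((\<lambda>v. f {v}) ` V)) k" using v k by auto
  then have "harm 1 \<le> (harm (min (Max ((\<lambda>v. f {v}) ` V)) k) :: real)" by (rule harm_mono)
  then show ?thesis by (simp add: harm_def)
qed

text \<open>Unless the empty set covers, an optimal cover contains an element that covers alone: for
  \<open>k = 1\<close> by subadditivity, for \<open>card V \<le> 1\<close> because the cover is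
  itself a singleton.\<close>

lemma cheapest_singleton_optimal:
  assumes "card V \<le> 1 \<or> k = 1"
  shows "cheapest_singleton V f c k \<subseteq> V \<and> k \<le> f (cheapest_singleton V f c k)
    \<and> sum c (cheapest_singleton V f c k) \<le> min_cover_cost V f c k"
proof (cases "k \<le> f {}")
  case True
  then show ?thesis using min_cover_cost_nonneg by (simp add: cheapest_singleton_def)
next
  case False
  let ?S = "{v \<in> V. k \<le> f {v}}"
  let ?w = "arg_min_on c ?S"
  obtain Q where Q: "Q \<subseteq> V" "k \<le> f Q" "sum c Q = min_cover_cost V f c k"
    using min_cover_cost_attained[where f = f and c = c, OF fin coverable] by blast
  have "Q \<noteq> {}" using Q False by auto
  have "\<exists>v\<in>Q. k \<le> f {v}"
  proof (cases "k = 1")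
    case True
    then show ?thesis using ex_singleton_pos[OF Q(1) \<open>Q \<noteq> {}\<close>] Q(2) by (auto simp: Suc_le_eq)
  next
    case False
    then have "card Q \<le> 1" using assms card_mono[OF fin Q(1)] by auto
    then have "card Q = 1" using \<open>Q \<noteq> {}\<close> finite_subset[OF Q(1) fin] by (simp add: le_Suc_eq)
    then show ?thesis using Q(2) by (auto simp: card_1_singleton_iff)
  qed
  then obtain v where v: "v \<in> Q" "k \<le> f {v}" by blast
  have S: "finite ?S" "v \<in> ?S" using fin v Q by auto
  have w: "?w \<in> ?S" using S by (intro arg_min_if_finite(1)) auto
  have "c ?w \<le> c v" using arg_min_least[OF S(1) _ S(2), of c] S(2) by blast
  also have "\<dots> \<le> sum c Q"
    using v Q nonneg finite_subset[OF Q(1) fin] by (intro member_le_sum) auto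
  finally show ?thesis using w False Q by (simp add: cheapest_singleton_def)
qed

text \<open>The largest cost in any cover is a feasible level by monotonicity. Applied to an optimal
  cover, it bounds the budget by one summand of the optimum, or by 0 if that cover is empty.\<close>

lemma budget:
  shows "k \<le> f {v \<in> V. c v \<le> budget V f c k}"
    and "0 \<le> budget V f c k" "budget V f c k \<le> min_cover_cost V f c k"
proof -
  let ?S = "{b \<in> insert 0 (c ` V). k \<le> f {v \<in> V. c v \<le> b}}"
  have finS: "finite ?S" using fin by simp
  have level: "Max (insert 0 (c ` A)) \<in> ?S" if A: "A \<subseteq> V" "k \<le> f A" for A
  proof -
    have finA: "finite A" using A fin finite_subset by blast
    have "A \<subseteq> {v \<in> V. c v \<le> Max (insert 0 (c ` A))}" using A finA by auto
    then have "f A \<le> f {v \<in> V. c v \<le> Max (insert 0 (c ` A))}"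
      using A by (intro mono_onD[OF mono]) auto
    moreover have "Max (insert 0 (c ` A)) \<in> insert 0 (c ` A)" using finA by (intro Max_in) auto
    ultimately show ?thesis using A by auto
  qed
  have "budget V f c k \<in> ?S"
    unfolding budget_def using finS level[of V] coverable by (intro Min_in) auto
  then show "k \<le> f {v \<in> V. c v \<le> budget V f c k}" "0 \<le> budget V f c k" using nonneg by auto
  obtain Q where Q: "Q \<subseteq> V" "k \<le> f Q" "sum c Q = min_cover_cost V f c k"
    using min_cover_cost_attained[where f = f and c = c, OF fin coverable] by blast
  have finQ: "finite Q" using Q fin finite_subset by blast
  have "budget V f c k \<le> Max (insert 0 (c ` Q))"
    unfolding budget_def using finS level[OF Q(1,2)] by (intro Min_le) auto
  also have "\<dots> \<le> sum c Q"
    using finQ Q(1) nonneg by (auto intro!: sum_nonneg member_le_sum)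
  finally show "budget V f c k \<le> min_cover_cost V f c k" using Q by simp
qed

lemma budget_cong:
  assumes "\<forall>S\<in>set (map (\<lambda>b. {v \<in> V. c v \<le> b}) (0 # map c (elements V))). F S = f S"
  shows "budget V F c k = budget V f c k"
proof -
  have "{b \<in> insert 0 (c ` V). k \<le> F {v \<in> V. c v \<le> b}} =
        {b \<in> insert 0 (c ` V). k \<le> f {v \<in> V. c v \<le> b}}"
    using assms elements[OF fin] by auto
  then show ?thesis by (simp add: budget_def)
qed

lemma cheapest_singleton_cong:
  assumes "\<forall>S\<in>set ({} # map (\<lambda>v. {v}) (elements V)). F S = f S"
  shows "cheapest_singleton V F c k = cheapest_singleton V f c k"
proof -
  have "{v \<in> V. k \<le> F {v}} = {v \<in> V. k \<le> f {v}}" using assms elements[OF fin] by auto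
  then show ?thesis using assms by (simp add: cheapest_singleton_def)
qed

lemma budget_cover_correct:
  fixes \<epsilon> :: real
  defines "B \<equiv> budget V f c k"
  assumes eps: "0 < \<epsilon>" "\<epsilon> < 1 / 5" and m: "2 \<le> card V" and k2: "2 \<le> k" and B: "B \<noteq> 0"
  shows "1 - \<epsilon> \<le> measure_pmf.prob (run f (budget_cover \<epsilon> V c k B))
        {V'. V' \<subseteq> V \<and> k \<le> f V' \<and>
             sum c V' \<le> harm (min (Max ((\<lambda>v. f {v}) ` V)) k) / (1 - 5 * \<epsilon>) * min_cover_cost V f c k}"
      (is "_ \<le> measure_pmf.prob _ ?good")
    and "rounds_within V f (trials \<epsilon> (card V) k * (card V + 1) ^ 2)
        (2 * iterations \<epsilon> (card V) k ^ 2) (budget_cover \<epsilon> V c k B)"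
proof -
  define m n L where "m = card V" and "n = iterations \<epsilon> m k" and "L = trials \<epsilon> m k"
  define cl ch where "cl = \<epsilon> * B / real m" and "ch = real m * B"
  define us where "us = filter (\<lambda>v. c v \<le> ch) (elements V)"
  define \<tau> where "\<tau> = (1 - \<epsilon>) * real k / cl"
  have m2: "2 \<le> m" using m by (simp add: m_def)
  have Bpos: "0 < B" using budget(2) B by (simp add: B_def)
  have us: "set us = {v \<in> V. c v \<le> ch}" "distinct us"
    using elements[OF fin] by (auto simp: us_def)
  have len: "length us \<le> m"
    using distinct_card[OF us(2)] us(1) card_mono[OF fin, of "set us"] by (auto simp: m_def)
  have B_le_ch: "B \<le> ch" using m2 Bpos by (simp add: ch_def)
  have clpos: "0 < cl" using eps Bpos m2 by (simp add: cl_def)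
  have "\<epsilon> * B / real m \<le> B"
  proof -
    have "\<epsilon> * B \<le> real m * B" using eps m2 Bpos by (intro mult_right_mono) auto
    then show ?thesis using m2 by (simp add: field_simps)
  qed
  then have cl_le: "cl \<le> B" by (simp add: cl_def)
  have prefix_sub: "{v \<in> V. c v \<le> B} \<subseteq> set us"
    unfolding us(1) using B_le_ch by (intro Collect_mono) linarith
  have feas_us: "k \<le> f (set us)"
  proof -
    have "k \<le> f {v \<in> V. c v \<le> B}" using budget(1) by (simp add: B_def)
    also have "\<dots> \<le> f (set us)" using mono prefix_sub us(1) by (auto simp: mono_on_def)
    finally show ?thesis .
  qed
  interpret covering us c k \<epsilon> L f cl ch
  proof
    show "submodular_on (set us) f" using submod us(1) by (auto intro: submodular_on_subset)
    show "mono_on (Pow (set us)) f" using us(1) by (intro mono_on_subset[OF mono]) auto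
    show "cl \<le> ch" using cl_le B_le_ch by simp
  qed (use feas_us eps clpos nonneg us(1) in auto)
  have alg: "budget_cover \<epsilon> V c k B = loop (levels n n \<tau>) cheap"
    unfolding budget_cover_def cheap_def
    by (simp add: Let_def \<tau>_def us_def ch_def cl_def L_def n_def m_def)
  obtain Q where Q: "Q \<subseteq> V" "k \<le> f Q" "sum c Q = min_cover_cost V f c k"
    using min_cover_cost_attained[where f = f and c = c, OF fin coverable] by blast
  \<comment> \<open>The level set of \<open>B\<close> is a cover with at most \<open>m\<close>
    elements, each of cost at most \<open>B\<close>.\<close>
  have opt_le: "min_cover_cost V f c k \<le> ch"
  proof -
    have "min_cover_cost V f c k \<le> sum c {v \<in> V. c v \<le> B}"
      using fin budget(1) by (intro min_cover_cost_le) (auto simp: B_def)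
    also have "\<dots> \<le> (\<Sum>v\<in>{v \<in> V. c v \<le> B}. B)" by (intro sum_mono) auto
    also have "\<dots> \<le> real m * B"
      using card_mono[OF fin, of "{v \<in> V. c v \<le> B}"] Bpos by (auto simp: m_def)
    finally show ?thesis by (simp add: ch_def)
  qed
  \<comment> \<open>No element of an optimal cover costs more than the optimum, so discarding the
    expensive ones loses nothing.\<close>
  have Qus: "Q \<subseteq> set us"
  proof
    fix v assume v: "v \<in> Q"
    then have "c v \<le> sum c Q"
      using Q nonneg finite_subset[OF Q(1) fin] by (intro member_le_sum) auto
    then show "v \<in> set us" using v Q opt_le us(1) by auto
  qed
  have pw: "(1 - \<epsilon>) ^ n \<le> \<epsilon> / (real k * real m ^ 3)"
    unfolding n_def using eps m2 k2 by (rule power_iterations_le)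
  \<comment> \<open>As \<open>ch / cl = real m ^ 2 / \<epsilon>\<close>, the factor
    \<open>real m ^ 3\<close> inside \<open>iterations\<close> serves this inequality and the factor
    \<open>k\<close> the next one.\<close>
  have n1: "(1 - \<epsilon>) ^ n * (real (length us) * ch) \<le> cl"
  proof -
    have "(1 - \<epsilon>) ^ n * (real (length us) * ch) \<le> \<epsilon> / (real k * real m ^ 3) * (real m * ch)"
      using pw len eps Bpos by (intro mult_mono) (auto simp: ch_def)
    also have "\<dots> = cl / real k" using m2 k2 by (simp add: cl_def ch_def power3_eq_cube)
    also have "\<dots> \<le> cl" using clpos k2 by (simp add: divide_le_eq)
    finally show ?thesis .
  qed
  have n2: "(1 - \<epsilon>) ^ n * (real k * ch) < cl"
  proof -
    have "(1 - \<epsilon>) ^ n * (real k * ch) \<le> \<epsilon> / (real k * real m ^ 3) * (real k * ch)"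
      using pw Bpos by (intro mult_right_mono) (auto simp: ch_def)
    also have "\<dots> = cl / real m" using m2 k2 by (simp add: cl_def ch_def power3_eq_cube)
    also have "\<dots> < cl" using clpos m2 by (simp add: divide_less_eq)
    finally show ?thesis .
  qed
  have cheap_cost: "sum c cheap \<le> \<epsilon> * min_cover_cost V f c k"
  proof -
    have "sum c cheap \<le> (\<Sum>v\<in>cheap. cl)" by (intro sum_mono) (auto simp: cheap_def)
    also have "\<dots> = real (card cheap) * cl" by simp
    also have "\<dots> \<le> real m * cl"
    proof -
      have "cheap \<subseteq> V" using us(1) by (auto simp: cheap_def)
      then show ?thesis using card_mono[OF fin, of cheap] clpos by (simp add: m_def)
    qed
    also have "\<dots> = \<epsilon> * B" using m2 by (simp add: cl_def)
    also have "\<dots> \<le> \<epsilon> * min_cover_cost V f c k"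
      using budget(3) eps by (intro mult_left_mono) (auto simp: B_def)
    finally show ?thesis .
  qed
  have good: "R \<in> ?good" if "chain (levels n n \<tau>) cheap R" for R
  proof -
    have h: "min (f {v}) k \<le> min (Max ((\<lambda>v. f {v}) ` V)) k" if "v \<in> Q" for v
      using that Q fin by (intro min.mono Max_ge) auto
    have R: "R \<subseteq> set us" "k \<le> f R"
      "(1 - 2 * \<epsilon>) * (sum c R - sum c cheap)
        \<le> harm (min (Max ((\<lambda>v. f {v}) ` V)) k) / (1 - \<epsilon>) * sum c Q"
      using cover_cost_le[OF Qus Q(2) that[unfolded \<tau>_def] k n1 n2 h] by auto
    have "V \<noteq> {}" using m by auto
    then have "sum c R \<le> harm (min (Max ((\<lambda>v. f {v}) ` V)) k) / (1 - 5 * \<epsilon>) * min_cover_cost V f c k"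
      using approximation_slack[OF eps harm_ge_1 min_cover_cost_nonneg cheap_cost] R(3) Q(3) by simp
    then show ?thesis using R us(1) by auto
  qed
  let ?\<alpha> = "\<epsilon> * (1 - \<epsilon>) * cl / (real (length us) * ch)"
  have rate: "\<epsilon> ^ 2 / (2 * real m ^ 3) \<le> ?\<alpha>"
  proof -
    \<comment> \<open>Otherwise the empty set would cover, and the optimum would be at most 0, below
      the budget.\<close>
    have "us \<noteq> []"
    proof -
      obtain v where "v \<in> V" "c v \<le> B"
      proof (cases "{v \<in> V. c v \<le> B} = {}")
        case True
        have "k \<le> f {v \<in> V. c v \<le> B}" using budget(1) by (simp only: B_def)
        then have "k \<le> f {}" by (simp only: True)
        then have "min_cover_cost V f c k \<le> sum c {}" using fin by (intro min_cover_cost_le) auto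
        then show thesis using budget(3) Bpos by (simp add: B_def)
      qed blast
      then show ?thesis using prefix_sub by auto
    qed
    then have lpos: "0 < real (length us)" by simp
    \<comment> \<open>The factor 2 comes from \<open>1 - \<epsilon> \<ge> 1 / 2\<close>.\<close>
    have "\<epsilon> ^ 2 / (2 * real m ^ 3) \<le> \<epsilon> * (1 - \<epsilon>) * cl / (real m * ch)"
    proof -
      have "\<epsilon> * (1 - \<epsilon>) * cl / (real m * ch) = \<epsilon> ^ 2 * (1 - \<epsilon>) / real m ^ 3"
        using Bpos m2 by (simp add: cl_def ch_def power2_eq_square power3_eq_cube mult_ac)
      moreover have "\<epsilon> ^ 2 * (1 / 2) / real m ^ 3 \<le> \<epsilon> ^ 2 * (1 - \<epsilon>) / real m ^ 3"
        using eps by (intro divide_right_mono mult_left_mono) auto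
      ultimately show ?thesis by simp
    qed
    also have "\<dots> \<le> ?\<alpha>"
      using eps clpos lpos len B_le_ch Bpos m2
      by (intro divide_left_mono mult_right_mono mult_pos_pos) auto
    finally show ?thesis .
  qed
  have "1 - \<epsilon> \<le> (1 - (1 - ?\<alpha>) ^ L) ^ (n ^ 2)"
    unfolding L_def n_def using eps m2 k2 rate success_rate_le_1 by (rule trials_failure_le)
  also have "\<dots> \<le> measure_pmf.prob (run f (loop (levels n n \<tau>) cheap)) {R. chain (levels n n \<tau>) cheap R}"
  proof -
    have "0 < \<tau>" using eps k clpos by (simp add: \<tau>_def)
    then have "(1 - (1 - ?\<alpha>) ^ L) ^ length (levels n n \<tau>)
        \<le> measure_pmf.prob (run f (loop (levels n n \<tau>) cheap)) {R. chain (levels n n \<tau>) cheap R}"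
      using levels_pos by (intro prob_chain) (auto simp: admissible_def cheap_def)
    then show ?thesis by (simp add: length_levels power2_eq_square)
  qed
  also have "\<dots> \<le> measure_pmf.prob (run f (loop (levels n n \<tau>) cheap)) ?good"
    using good by (intro measure_pmf.finite_measure_mono) auto
  finally show "1 - \<epsilon> \<le> measure_pmf.prob (run f (budget_cover \<epsilon> V c k B)) ?good"
    by (simp add: alg)
  have "rounds_within V f (L * (m + 1) ^ 2) (2 * length (levels n n \<tau>)) (loop (levels n n \<tau>) cheap)"
  proof (rule rounds_within_loop)
    show "L * (length us + 1)\<^sup>2 \<le> L * (m + 1)\<^sup>2"
      using len by (intro mult_le_mono power_mono) auto
    show "1 \<le> L" unfolding L_def using eps m2 k2 by (rule trials_pos)
  qed (use us in \<open>auto simp: cheap_def\<close>)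
  then show "rounds_within V f (trials \<epsilon> (card V) k * (card V + 1) ^ 2)
        (2 * iterations \<epsilon> (card V) k ^ 2) (budget_cover \<epsilon> V c k B)"
    by (simp add: alg length_levels power2_eq_square L_def n_def m_def)
qed

lemma cover_alg_correct:
  assumes eps: "0 < \<epsilon>" "\<epsilon> < 1 / 5"
  shows "1 - 3 * \<epsilon> \<le> measure_pmf.prob (run f (cover_alg \<epsilon> V c k))
        {V'. V' \<subseteq> V \<and> k \<le> f V' \<and>
             sum c V' \<le> harm (min (Max ((\<lambda>v. f {v}) ` V)) k) / (1 - 5 * \<epsilon>) * min_cover_cost V f c k}"
      (is "_ \<le> measure_pmf.prob _ ?good")
    and "\<exists>r q. rounds_within V f q r (cover_alg \<epsilon> V c k)
         \<and> real r \<le> 201 * round_bound \<epsilon> (card V) k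
         \<and> real q \<le> 204 * (real (card V) + ln (real k) + 1 / \<epsilon>) ^ 14"
proof -
  let ?s = "real (card V) + ln (real k) + 1 / \<epsilon>"
  have good: "A \<in> ?good" if A: "A \<subseteq> V" "k \<le> f A" "sum c A \<le> min_cover_cost V f c k" for A
  proof (cases "V = {}")
    \<comment> \<open>The maximum over an empty \<open>V\<close> is unspecified, but the optimum is
      0 and makes the bound vanish whatever the harmonic factor is.\<close>
    case True
    then have "A = {}" "min_cover_cost V f c k = 0"
      using A min_cover_cost_nonneg min_cover_cost_le[of V "{}" k f c] by auto
    then show ?thesis using A by simp
  next
    case False
    have "1 * (1 - 5 * \<epsilon>) \<le> harm (min (Max ((\<lambda>v. f {v}) ` V)) k) * 1"
      using harm_ge_1[OF False] eps by (intro mult_mono) auto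
    then have "1 \<le> harm (min (Max ((\<lambda>v. f {v}) ` V)) k) / (1 - 5 * \<epsilon>)"
      using eps by (simp add: pos_le_divide_eq)
    then have "1 * min_cover_cost V f c k
        \<le> harm (min (Max ((\<lambda>v. f {v}) ` V)) k) / (1 - 5 * \<epsilon>) * min_cover_cost V f c k"
      using min_cover_cost_nonneg by (intro mult_right_mono)
    then show ?thesis using A by auto
  qed
  have len: "length (elements V) = card V"
    using elements[OF fin] distinct_card by metis
  have "5 \<le> 1 / \<epsilon>" using eps by (simp add: field_simps)
  moreover have "0 \<le> ln (real k)" using k by (intro ln_ge_zero) simp
  ultimately have s: "real (card V) + 1 \<le> ?s" by linarith
  show "1 - 3 * \<epsilon> \<le> measure_pmf.prob (run f (cover_alg \<epsilon> V c k)) ?good"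
  proof (cases "card V \<le> 1 \<or> k = 1")
    case True
    have "run f (cover_alg \<epsilon> V c k) = return_pmf (cheapest_singleton V f c k)"
      unfolding cover_alg_def if_P[OF True]
      by (subst run_ask) (simp_all only: cheapest_singleton_cong run.simps)
    then show ?thesis
      using good[of "cheapest_singleton V f c k"] cheapest_singleton_optimal[OF True] eps
      by (simp add: indicator_def)
  next
    case False
    then have 2: "2 \<le> card V" "2 \<le> k" using k by auto
    let ?B = "budget V f c k"
    have run: "run f (cover_alg \<epsilon> V c k) =
        run f (if ?B = 0 then Output {v \<in> V. c v \<le> 0} else budget_cover \<epsilon> V c k ?B)"
      unfolding cover_alg_def if_not_P[OF False] Let_def
      by (subst run_ask) (simp_all only: budget_cong)
    show ?thesis
    proof (cases "?B = 0")
      case True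
      \<comment> \<open>At budget 0 the free elements already form a cover, which is
        optimal.\<close>
      have "sum c {v \<in> V. c v \<le> 0} \<le> 0" by (intro sum_nonpos) auto
      then have "{v \<in> V. c v \<le> 0} \<in> ?good"
        using budget(1) min_cover_cost_nonneg True by (intro good) auto
      then show ?thesis using run True eps by (simp add: indicator_def)
    next
      case B: False
      then show ?thesis using run budget_cover_correct(1)[OF eps 2 B] eps by simp
    qed
  qed
  show "\<exists>r q. rounds_within V f q r (cover_alg \<epsilon> V c k)
         \<and> real r \<le> 201 * round_bound \<epsilon> (card V) k \<and> real q \<le> 204 * ?s ^ 14"
  proof (cases "card V \<le> 1 \<or> k = 1")
    case True
    have "rounds_within V f (card V + 1) (Suc 0) (cover_alg \<epsilon> V c k)"
      unfolding cover_alg_def if_P[OF True]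
      by (rule rounds_within_ask, simp only: cheapest_singleton_cong)
        (use elements[OF fin] len in \<open>auto intro: rounds_within.Output\<close>)
    moreover have "real (Suc 0) \<le> 201 * round_bound \<epsilon> (card V) k"
      by (simp add: round_bound_def)
    moreover have "real (card V + 1) \<le> 204 * ?s ^ 14"
    proof -
      have "?s ^ 1 \<le> ?s ^ 14" using s by (intro power_increasing) auto
      then show ?thesis using s by simp
    qed
    ultimately show ?thesis by blast
  next
    case False
    then have 2: "2 \<le> card V" "2 \<le> k" using k by auto
    let ?B = "budget V f c k"
    let ?r = "2 * iterations \<epsilon> (card V) k ^ 2"
    let ?q = "trials \<epsilon> (card V) k * (card V + 1) ^ 2"
    have "rounds_within V f ?q ?r
        (if ?B = 0 then Output {v \<in> V. c v \<le> 0} else budget_cover \<epsilon> V c k ?B)"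
      using budget_cover_correct(2)[OF eps 2] by (auto intro: rounds_within.Output)
    moreover have "card V + 1 \<le> ?q"
    proof -
      have "1 * (card V + 1) ^ 1 \<le> ?q"
        using trials_pos[OF eps 2] by (intro mult_le_mono power_increasing) auto
      then show ?thesis by simp
    qed
    \<comment> \<open>The additional round is the one that determines the budget.\<close>
    ultimately have "rounds_within V f ?q (Suc ?r) (cover_alg \<epsilon> V c k)"
      unfolding cover_alg_def if_not_P[OF False] Let_def
      by (intro rounds_within_ask, simp_all only: budget_cong) (auto simp: len)
    moreover have "real (Suc ?r) \<le> 201 * round_bound \<epsilon> (card V) k"
      using rounds_le[OF eps 2] by simp
    moreover have "real ?q \<le> 204 * ?s ^ 14" by (rule queries_le[OF eps 2])
    ultimately show ?thesis by blast
  qed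
qed

end

theorem theorem13:
  shows "\<exists>(C :: real) (K :: real) (d :: nat).
    \<forall>\<epsilon> :: real. 0 < \<epsilon> \<and> \<epsilon> < 1 / 5 \<longrightarrow>
      (\<exists>alg :: 'a set \<Rightarrow> ('a \<Rightarrow> real) \<Rightarrow> nat \<Rightarrow> 'a oracle_alg.
        \<forall>(V :: 'a set) (f :: 'a set \<Rightarrow> nat) (c :: 'a \<Rightarrow> real) (k :: nat).
          finite V \<longrightarrow> submodular_on V f \<longrightarrow> mono_on (Pow V) f \<longrightarrow>
          (\<forall>v\<in>V. 0 \<le> c v) \<longrightarrow> 0 < k \<longrightarrow> k \<le> f V \<longrightarrow>
            measure_pmf.prob (run f (alg V c k))
              {V'. V' \<subseteq> V \<and> k \<le> f V' \<and>
                   sum c V' \<le> harm (min (Max ((\<lambda>v. f {v}) ` V)) k) / (1 - 5 * \<epsilon>)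
                              * min_cover_cost V f c k}
              \<ge> 1 - 3 * \<epsilon>
            \<and> (\<exists>r q. rounds_within V f q r (alg V c k)
                 \<and> real r \<le> C * round_bound \<epsilon> (card V) k
                 \<and> real q \<le> K * (real (card V) + ln (real k) + 1 / \<epsilon>) ^ d))"
proof (rule exI[of _ 201], rule exI[of _ 204], rule exI[of _ 14], intro allI impI)
  fix \<epsilon> :: real
  assume "0 < \<epsilon> \<and> \<epsilon> < 1 / 5"
  then show "\<exists>alg :: 'a set \<Rightarrow> ('a \<Rightarrow> real) \<Rightarrow> nat \<Rightarrow> 'a oracle_alg.
        \<forall>(V :: 'a set) (f :: 'a set \<Rightarrow> nat) (c :: 'a \<Rightarrow> real) (k :: nat).
          finite V \<longrightarrow> submodular_on V f \<longrightarrow> mono_on (Pow V) f \<longrightarrow>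
          (\<forall>v\<in>V. 0 \<le> c v) \<longrightarrow> 0 < k \<longrightarrow> k \<le> f V \<longrightarrow>
            measure_pmf.prob (run f (alg V c k))
              {V'. V' \<subseteq> V \<and> k \<le> f V' \<and>
                   sum c V' \<le> harm (min (Max ((\<lambda>v. f {v}) ` V)) k) / (1 - 5 * \<epsilon>)
                              * min_cover_cost V f c k}
              \<ge> 1 - 3 * \<epsilon>
            \<and> (\<exists>r q. rounds_within V f q r (alg V c k)
                 \<and> real r \<le> 201 * round_bound \<epsilon> (card V) k
                 \<and> real q \<le> 204 * (real (card V) + ln (real k) + 1 / \<epsilon>) ^ 14)"
    by (intro exI[of _ "cover_alg \<epsilon>"] allI impI conjI cover_alg_correct) auto
qed

end
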